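(* Let $M$ be a smooth $n$-dimensional manifold equipped with a semi-Riemannian metric $g$ of regularity $\mathcal{C}^{0,1}$ (i.e. locally Lipschitz continuous). Then there exist Filippov solutions of the geodesic equation of $g$, written in local coordinates as $$\ddot x^i=-\Gamma^i_{jk}(x)\,\dot x^j\dot x^k ,\qquad i=1,\dots,n,$$ which are $\mathcal{C}^1$-curves.
   Context: Metric and Christoffel symbols. A $\mathcal{C}^{0,1}$-semi-Riemannian metric $g$ on $M$ is a symmetric, nondegenerate $(0,2)$-tensor field of constant signature whose components $g_{ij}$ in every smooth chart are locally Lipschitz continuous. By Rademacher's theorem the $g_{ij}$ are differentiable almost everywhere with locally bounded derivatives. Hence the Christoffel symbols $\Gamma^i_{jk}=\tfrac12 g^{il}(\partial_j g_{lk}+\partial_k g_{lj}-\partial_l g_{jk})$ (summation convention) are defined almost everywhere in the chart and belong to $L^\infty_{\mathrm{loc}}$. Filippov solutions. Let $U\subseteq\mathbb{R}^m$ be open and let $F\colon U\to\mathbb{R}^m$ be a (possibly discontinuous, almost everywhere defined) vector field with $F\in L^\infty_{\mathrm{loc}}(U;\mathbb{R}^m)$. The Filippov set-valued map $\mathcal{F}[F]$ associated with $F$ assigns to each $z\in U$ the closed convex set $$\mathcal{F}[F](z):=\bigcap_{\delta>0}\ \bigcap_{\mu(S)=0}\mathrm{co}\Big(F\big(B(z,\delta)\setminus S\big)\Big)\subseteq\mathbb{R}^m,$$ where $\mathrm{co}(B)$ denotes the closed convex hull of a set $B$, $B(z,\delta)$ is the closed ball of radius $\delta$ around $z$ (only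 its points in $U$ at which $F$ is defined are considered), $\mu$ is Lebesgue measure on $\mathbb{R}^m$, and the inner intersection runs over all Lebesgue null sets $S$. A Filippov solution of the autonomous system $\dot z(t)=F(z(t))$ is an absolutely continuous curve $z\colon I\to U$, defined on some (nondegenerate) interval $I$, such that $\dot z(t)\in\mathcal{F}[F](z(t))$ for almost every $t\in I$. Filippov solutions of the geodesic equation. In a smooth chart of $M$ with coordinate domain identified with an open set $V\subseteq\mathbb{R}^n$, the geodesic equation is rewritten as the first order system $\dot z=F(z)$ in the $2n$ variables $z=(x,v)\in V\times\mathbb{R}^n$ (with $v$ playing the role of $\dot x$), where $$F(x,v)=\big(v^1,\dots,v^n,\,-\Gamma^1_{jk}(x)v^jv^k,\dots,-\Gamma^n_{jk}(x)v^jv^k\big).$$ A Filippov solution of the geodesic equation is the component $x$ of a Filippov solution $z=(x,v)$ of this first order system. *)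

theory Defs
  imports "HOL-Analysis.Analysis"
begin

section \<open>Smooth manifolds\<close>

text \<open>The recursion only uses interior derivatives, so these notions are meant for open sets.\<close>

primrec Ck_on :: "nat \<Rightarrow> 'a::real_normed_vector set \<Rightarrow> ('a \<Rightarrow> 'b::real_normed_vector) \<Rightarrow> bool"
  where
    "Ck_on 0 S f \<longleftrightarrow> continuous_on S f"
  | "Ck_on (Suc k) S f \<longleftrightarrow>
       (\<forall>x\<in>S. f differentiable (at x)) \<and>
       (\<forall>v. Ck_on k S (\<lambda>x. frechet_derivative f (at x) v))"

definition smooth_on :: "'a::real_normed_vector set \<Rightarrow> ('a \<Rightarrow> 'b::real_normed_vector) \<Rightarrow> bool"
  where "smooth_on S f \<longleftrightarrow> (\<forall>k. Ck_on k S f)"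

text \<open>A chart is a pair of its domain and its coordinate map; values of the coordinate map
  outside the domain are irrelevant.\<close>

type_synonym ('a, 'n) chart = "'a set \<times> ('a \<Rightarrow> real ^ 'n)"

definition chart_image :: "('a, 'n::finite) chart \<Rightarrow> (real ^ 'n) set"
  where "chart_image c = snd c ` fst c"

definition chart_inv :: "('a, 'n::finite) chart \<Rightarrow> real ^ 'n \<Rightarrow> 'a"
  where "chart_inv c = inv_into (fst c) (snd c)"

definition is_chart :: "'a topology \<Rightarrow> ('a, 'n::finite) chart \<Rightarrow> bool"
  where "is_chart M c \<longleftrightarrow>
    openin M (fst c) \<and> open (chart_image c) \<and>
    homeomorphic_map (subtopology M (fst c)) (top_of_set (chart_image c)) (snd c)"

definition transition :: "('a, 'n::finite) chart \<Rightarrow> ('a, 'n) chart \<Rightarrow> real ^ 'n \<Rightarrow> real ^ 'n"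
  where "transition c d = snd d \<circ> chart_inv c"

definition compatible :: "('a, 'n::finite) chart \<Rightarrow> ('a, 'n) chart \<Rightarrow> bool"
  where "compatible c d \<longleftrightarrow>
    smooth_on (snd c ` (fst c \<inter> fst d)) (transition c d) \<and>
    smooth_on (snd d ` (fst c \<inter> fst d)) (transition d c)"

definition smooth_manifold :: "'a topology \<Rightarrow> ('a, 'n::finite) chart set \<Rightarrow> bool"
  where "smooth_manifold M A \<longleftrightarrow>
    Hausdorff_space M \<and> second_countable M \<and>
    (\<forall>c\<in>A. is_chart M c) \<and> topspace M = (\<Union>c\<in>A. fst c) \<and>
    (\<forall>c\<in>A. \<forall>d\<in>A. compatible c d) \<and>
    (\<forall>c. is_chart M c \<and> (\<forall>d\<in>A. compatible c d) \<longrightarrow> c \<in> A)"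

definition charts_at :: "('a, 'n) chart set \<Rightarrow> 'a \<Rightarrow> ('a, 'n) chart set"
  where "charts_at A p = {c \<in> A. p \<in> fst c}"


section \<open>Tangent vectors and semi-Riemannian metrics\<close>

text \<open>A tangent vector at \<open>p\<close> is the family of its coordinate vectors in all charts around \<open>p\<close>,
  related by the derivatives of the chart transitions. The family is \<open>0\<close> at all other charts,
  so that equality of tangent vectors is equality of functions; addition and scaling
  are pointwise.\<close>

type_synonym ('a, 'n) tangent = "('a, 'n) chart \<Rightarrow> real ^ 'n"

definition tangent_space :: "('a, 'n::finite) chart set \<Rightarrow> 'a \<Rightarrow> ('a, 'n) tangent set"
  where "tangent_space A p = {\<xi>.
    (\<forall>c. c \<notin> charts_at A p \<longrightarrow> \<xi> c = 0) \<and>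
    (\<forall>c\<in>charts_at A p. \<forall>d\<in>charts_at A p.
       \<xi> d = frechet_derivative (transition c d) (at (snd c p)) (\<xi> c))}"

text \<open>The tangent vector at \<open>p\<close> with coordinate vector \<open>u\<close> in the chart \<open>c\<close>.\<close>

definition tangent_of :: "('a, 'n::finite) chart set \<Rightarrow> ('a, 'n) chart \<Rightarrow> 'a \<Rightarrow> real ^ 'n
    \<Rightarrow> ('a, 'n) tangent"
  where "tangent_of A c p u = (\<lambda>d. if d \<in> charts_at A p
    then frechet_derivative (transition c d) (at (snd c p)) u else 0)"

type_synonym ('a, 'n) tensor02 = "'a \<Rightarrow> ('a, 'n) tangent \<Rightarrow> ('a, 'n) tangent \<Rightarrow> real"

definition symmetric_form :: "('a, 'n::finite) tangent set
    \<Rightarrow> (('a, 'n) tangent \<Rightarrow> ('a, 'n) tangent \<Rightarrow> real) \<Rightarrow> bool"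
  where "symmetric_form T b \<longleftrightarrow>
    (\<forall>\<xi>\<in>T. \<forall>\<eta>\<in>T. b \<xi> \<eta> = b \<eta> \<xi>) \<and>
    (\<forall>\<xi>\<in>T. \<forall>\<eta>\<in>T. \<forall>\<zeta>\<in>T. b (\<lambda>c. \<xi> c + \<eta> c) \<zeta> = b \<xi> \<zeta> + b \<eta> \<zeta>) \<and>
    (\<forall>a. \<forall>\<xi>\<in>T. \<forall>\<zeta>\<in>T. b (\<lambda>c. a *\<^sub>R \<xi> c) \<zeta> = a * b \<xi> \<zeta>)"

definition nondegenerate_form :: "('a, 'n::finite) tangent set
    \<Rightarrow> (('a, 'n) tangent \<Rightarrow> ('a, 'n) tangent \<Rightarrow> real) \<Rightarrow> bool"
  where "nondegenerate_form T b \<longleftrightarrow>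
    (\<forall>\<xi>\<in>T. (\<forall>\<eta>\<in>T. b \<xi> \<eta> = 0) \<longrightarrow> \<xi> = (\<lambda>_. 0))"

definition metric_comp :: "('a, 'n::finite) chart set \<Rightarrow> ('a, 'n) tensor02 \<Rightarrow> ('a, 'n) chart
    \<Rightarrow> real ^ 'n \<Rightarrow> real ^ 'n ^ 'n"
  where "metric_comp A g c x = (\<chi> i j. g (chart_inv c x)
    (tangent_of A c (chart_inv c x) (axis i 1)) (tangent_of A c (chart_inv c x) (axis j 1)))"

text \<open>Maximal dimensions of a positive definite and of a negative definite subspace.\<close>

definition signature :: "real ^ 'n ^ 'n::finite \<Rightarrow> nat \<times> nat"
  where "signature B =
    (Max {dim W | W. subspace W \<and> (\<forall>w\<in>W - {0}. w \<bullet> (B *v w) > 0)},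
     Max {dim W | W. subspace W \<and> (\<forall>w\<in>W - {0}. w \<bullet> (B *v w) < 0)})"

definition locally_lipschitz_on :: "'a::metric_space set \<Rightarrow> ('a \<Rightarrow> 'b::metric_space) \<Rightarrow> bool"
  where "locally_lipschitz_on S f \<longleftrightarrow>
    (\<forall>x\<in>S. \<exists>r>0. \<exists>L. L-lipschitz_on (ball x r \<inter> S) f)"

definition lipschitz_semi_riemannian_metric ::
    "'a topology \<Rightarrow> ('a, 'n::finite) chart set \<Rightarrow> ('a, 'n) tensor02 \<Rightarrow> bool"
  where "lipschitz_semi_riemannian_metric M A g \<longleftrightarrow>
    (\<forall>p\<in>topspace M. symmetric_form (tangent_space A p) (g p) \<and>
       nondegenerate_form (tangent_space A p) (g p)) \<and>
    (\<exists>s. \<forall>c\<in>A. \<forall>x\<in>chart_image c. signature (metric_comp A g c x) = s) \<and>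
    (\<forall>c\<in>A. \<forall>i j. locally_lipschitz_on (chart_image c) (\<lambda>x. metric_comp A g c x $ i $ j))"


section \<open>Christoffel symbols and the geodesic vector field\<close>

definition has_partial :: "(real ^ 'n::finite \<Rightarrow> real) \<Rightarrow> 'n \<Rightarrow> real ^ 'n \<Rightarrow> bool"
  where "has_partial f k x \<longleftrightarrow> (\<lambda>t. f (x + t *\<^sub>R axis k 1)) field_differentiable (at 0)"

definition partial :: "(real ^ 'n::finite \<Rightarrow> real) \<Rightarrow> 'n \<Rightarrow> real ^ 'n \<Rightarrow> real"
  where "partial f k x = deriv (\<lambda>t. f (x + t *\<^sub>R axis k 1)) 0"

definition christoffel :: "('a, 'n::finite) chart set \<Rightarrow> ('a, 'n) tensor02 \<Rightarrow> ('a, 'n) chart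
    \<Rightarrow> 'n \<Rightarrow> 'n \<Rightarrow> 'n \<Rightarrow> real ^ 'n \<Rightarrow> real"
  where "christoffel A g c i j k x = 1/2 * (\<Sum>l\<in>UNIV.
    matrix_inv (metric_comp A g c x) $ i $ l *
      (partial (\<lambda>y. metric_comp A g c y $ l $ k) j x
       + partial (\<lambda>y. metric_comp A g c y $ l $ j) k x
       - partial (\<lambda>y. metric_comp A g c y $ j $ k) l x))"

text \<open>The set of points where all partial derivatives of the components exist, that is, where
  the Christoffel symbols are defined. For Lipschitz components it has full measure in the
  chart image.\<close>

definition christoffel_dom :: "('a, 'n::finite) chart set \<Rightarrow> ('a, 'n) tensor02 \<Rightarrow> ('a, 'n) chart
    \<Rightarrow> (real ^ 'n) set"
  where "christoffel_dom A g c =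
    {x \<in> chart_image c. \<forall>i j k. has_partial (\<lambda>y. metric_comp A g c y $ i $ j) k x}"

definition geodesic_field :: "('a, 'n::finite) chart set \<Rightarrow> ('a, 'n) tensor02 \<Rightarrow> ('a, 'n) chart
    \<Rightarrow> (real ^ 'n) \<times> (real ^ 'n) \<Rightarrow> (real ^ 'n) \<times> (real ^ 'n)"
  where "geodesic_field A g c = (\<lambda>(x, v).
    (v, \<chi> i. - (\<Sum>j\<in>UNIV. \<Sum>k\<in>UNIV. christoffel A g c i j k x * v $ j * v $ k)))"


section \<open>Filippov solutions\<close>

text \<open>An almost everywhere defined vector field is a total function \<open>F\<close> together with the set
  \<open>D\<close> where it is defined.\<close>

definition filippov_map :: "'b::euclidean_space set \<Rightarrow> ('b \<Rightarrow> 'b) \<Rightarrow> 'b \<Rightarrow> 'b set"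
  where "filippov_map D F z =
    (\<Inter>\<delta>\<in>{0<..}. \<Inter>S\<in>{S. negligible S}. closure (convex hull (F ` (cball z \<delta> \<inter> D - S))))"

text \<open>A division of its own union is a finite family of nonoverlapping compact intervals.\<close>

definition absolutely_continuous_on :: "real set \<Rightarrow> (real \<Rightarrow> 'b::real_normed_vector) \<Rightarrow> bool"
  where "absolutely_continuous_on I f \<longleftrightarrow>
    (\<forall>\<epsilon>>0. \<exists>\<delta>>0. \<forall>\<D>. \<D> division_of \<Union>\<D> \<and> \<Union>\<D> \<subseteq> I \<and> (\<Sum>K\<in>\<D>. Sup K - Inf K) < \<delta>
       \<longrightarrow> (\<Sum>K\<in>\<D>. norm (f (Sup K) - f (Inf K))) < \<epsilon>)"

definition filippov_solution :: "'b::euclidean_space set \<Rightarrow> 'b set \<Rightarrow> ('b \<Rightarrow> 'b)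
    \<Rightarrow> real set \<Rightarrow> (real \<Rightarrow> 'b) \<Rightarrow> bool"
  where "filippov_solution U D F I z \<longleftrightarrow>
    is_interval I \<and> (\<exists>a\<in>I. \<exists>b\<in>I. a < b) \<and> z ` I \<subseteq> U \<and> absolutely_continuous_on I z \<and>
    (AE t in lebesgue. t \<in> I \<longrightarrow>
       (\<exists>w\<in>filippov_map D F (z t). (z has_vector_derivative w) (at t within I)))"

definition filippov_geodesic :: "('a, 'n::finite) chart set \<Rightarrow> ('a, 'n) tensor02 \<Rightarrow> ('a, 'n) chart
    \<Rightarrow> real set \<Rightarrow> (real \<Rightarrow> real ^ 'n) \<Rightarrow> bool"
  where "filippov_geodesic A g c I x \<longleftrightarrow>
    (\<exists>v. filippov_solution (chart_image c \<times> UNIV) (christoffel_dom A g c \<times> UNIV)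
       (geodesic_field A g c) I (\<lambda>t. (x t, v t)))"

end

theory Submission
  imports Defs "HOL-Complex_Analysis.Great_Picard"
begin

text \<open>Near a point of a chart the Christoffel symbols are bounded where they are defined, because
  the metric components are Lipschitz and their matrix is uniformly invertible there; so the geodesic
  vector field \<open>F\<close> is locally bounded, and by Rademacher's theorem for partial derivatives it is
  defined almost everywhere. For a bounded field the Filippov map has nonempty values (compactness),
  and Euler polygons built from any selection of it subconverge uniformly to a Lipschitz curve \<open>z\<close>.
  The difference quotients of the polygons over short intervals around \<open>t\<close> lie in the closed convex
  hull of the values of \<open>F\<close> near \<open>z t\<close> off a given null set, and this passes to the limit. Hence
  \<open>z\<close> is a Filippov solution where it is differentiable, that is, almost everywhere. Moreover the
  first component of \<open>F (x, v)\<close> is \<open>v\<close>, so the same inclusion shows that the position component has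
  derivative \<open>v t\<close> at every \<open>t\<close> and is therefore of class \<open>C\<^sup>1\<close>.\<close>

section \<open>Almost everywhere differentiability of Lipschitz functions\<close>

text \<open>Vitali's theorem selects disjoint intervals of slope at most \<open>r\<close> that lie
  in an open set barely larger than \<open>E\<close> and cover \<open>E\<close> up to a null set.
  Each image has measure at most \<open>r\<close> times the length of its interval, and the
  Lipschitz bound keeps the image of the null remainder null.\<close>

lemma emeasure_image_le_of_slopes:
  fixes F :: "real \<Rightarrow> real"
  assumes mono: "strict_mono F" and lip: "C-lipschitz_on UNIV F"
    and E: "E \<in> sets borel" "\<And>A. A \<in> sets borel \<Longrightarrow> F ` A \<in> sets borel" and r: "0 < r"
    and slopes: "\<And>x d. x \<in> E \<Longrightarrow> 0 < d \<Longrightarrow>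
      \<exists>a b. a < b \<and> b - a < d \<and> x \<in> {a..b} \<and> F b - F a \<le> r * (b - a)"
  shows "emeasure lborel (F ` E) \<le> ennreal r * emeasure lborel E"
proof (rule ennreal_le_epsilon)
  fix e :: real assume e: "e > 0"
  \<comment> \<open>The slack \<open>e / r\<close> becomes \<open>e\<close> after multiplication by
    \<open>r\<close>.\<close>
  obtain O' where O': "open O'" "E \<subseteq> O'" "emeasure lborel (O' - E) < ennreal (e / r)"
    using outer_regular_lborel[OF E(1), of "e / r"] e r by auto
  define K where "K = {(c, \<rho>). 0 < \<rho> \<and> cball c \<rho> \<subseteq> O' \<and> F (c + \<rho>) - F (c - \<rho>) \<le> r * (2 * \<rho>)}"
  have cov: "\<exists>i. i \<in> K \<and> x \<in> cball (fst i) (snd i) \<and> snd i < d" if x: "x \<in> E" "0 < d" for x d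
  proof -
    obtain \<eta> where \<eta>: "\<eta> > 0" "ball x \<eta> \<subseteq> O'"
      using O' x by (meson openE subsetD)
    obtain a b where ab: "a < b" "b - a < min d (\<eta> / 2)" "x \<in> {a..b}" "F b - F a \<le> r * (b - a)"
      using slopes[OF x(1), of "min d (\<eta> / 2)"] x(2) \<eta>(1) by auto
    \<comment> \<open>The covering theorem speaks of closed balls, so \<open>{a..b}\<close> is
      recentred at its midpoint, with \<open>x\<close> anywhere inside; its length is small enough
      to stay in \<open>ball x \<eta>\<close>.\<close>
    define c where "c = (a + b) / 2"
    define \<rho> where "\<rho> = (b - a) / 2"
    have "c + \<rho> = b" "c - \<rho> = a" "2 * \<rho> = b - a" by (auto simp: c_def \<rho>_def field_simps)
    then have c: "0 < \<rho>" "\<rho> < min d (\<eta> / 2)" "x \<in> cball c \<rho>"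
        "F (c + \<rho>) - F (c - \<rho>) \<le> r * (2 * \<rho>)"
      using ab by (auto simp: cball_eq_atLeastAtMost)
    have "cball c \<rho> \<subseteq> ball x \<eta>"
      using c(2,3) by (auto simp: dist_real_def)
    then have "(c, \<rho>) \<in> K" using c \<eta>(2) by (auto simp: K_def)
    then show ?thesis using c by (intro exI[of _ "(c, \<rho>)"]) auto
  qed
  have KO: "cball (fst i) (snd i) \<subseteq> O'" if "i \<in> K" for i using that by (auto simp: K_def)
  have pos: "0 < snd i" if "i \<in> K" for i using that by (auto simp: K_def)
  from Vitali_covering_theorem_cballs[of K snd E fst, OF pos cov]
  obtain C where C: "countable C" "C \<subseteq> K"
      "pairwise (\<lambda>i j. disjnt (cball (fst i) (snd i)) (cball (fst j) (snd j))) C"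
      "negligible (E - (\<Union>i\<in>C. cball (fst i) (snd i)))"
    by blast
  let ?B = "\<lambda>i. cball (fst i) (snd i :: real) :: real set"
  let ?N = "E - (\<Union>i\<in>C. ?B i)"
  have borelN: "?N \<in> sets borel"
    using E(1) C(1) by (intro sets.Diff sets.countable_UN') auto
  have "negligible (F ` ?N)"
  proof (rule negligible_locally_Lipschitz_image)
    show "\<exists>T B. open T \<and> x \<in> T \<and> (\<forall>y\<in>?N \<inter> T. norm (F y - F x) \<le> B * norm (y - x))" for x
      using lipschitz_onD[OF lip] by (intro exI[of _ UNIV] exI[of _ C]) (auto simp: dist_norm)
  qed (use C(4) in auto)
  then have N0: "emeasure lborel (F ` ?N) = 0"
    using E(2)[OF borelN] by (simp add: negligible_iff_null_sets null_sets_def)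
  have img: "F ` ?B i \<subseteq> {F (fst i - snd i)..F (fst i + snd i)}" for i
    using mono by (auto simp: cball_eq_atLeastAtMost strict_mono_less_eq)
  have FB: "F ` ?B i \<in> sets borel" for i by (intro E(2)) auto
  have disj: "disjoint_family_on ?B C"
    using C(3) by (auto simp: disjoint_family_on_def pairwise_def disjnt_def)
  have disjF: "disjoint_family_on (\<lambda>i. F ` ?B i) C"
    using disj strict_mono_imp_inj_on[OF mono]
    unfolding disjoint_family_on_def by (metis image_Int image_empty)
  have le: "emeasure lborel (F ` ?B i) \<le> ennreal r * emeasure lborel (?B i)" if "i \<in> C" for i
  proof -
    have i: "0 < snd i" "F (fst i + snd i) - F (fst i - snd i) \<le> r * (2 * snd i)"
      using that C(2) by (auto simp: K_def)
    have "emeasure lborel (F ` ?B i) \<le> emeasure lborel {F (fst i - snd i)..F (fst i + snd i)}"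
      using img by (intro emeasure_mono) auto
    also have "\<dots> = ennreal (F (fst i + snd i) - F (fst i - snd i))"
      using i(1) mono by (intro emeasure_lborel_Icc) (simp add: strict_mono_less_eq)
    also have "\<dots> \<le> ennreal (r * (2 * snd i))" using i(2) by (rule ennreal_leI)
    also have "\<dots> = ennreal r * emeasure lborel (?B i)"
      using i(1) r by (simp add: cball_eq_atLeastAtMost ennreal_mult)
    finally show ?thesis .
  qed
  have "emeasure lborel (F ` E) \<le> emeasure lborel (F ` ?N \<union> (\<Union>i\<in>C. F ` ?B i))"
  proof (rule emeasure_mono)
    show "F ` E \<subseteq> F ` ?N \<union> (\<Union>i\<in>C. F ` ?B i)" by blast
    show "F ` ?N \<union> (\<Union>i\<in>C. F ` ?B i) \<in> sets lborel"
      using E(2)[OF borelN] FB C(1) by (intro sets.Un sets.countable_UN') auto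
  qed
  also have "\<dots> \<le> emeasure lborel (F ` ?N) + emeasure lborel (\<Union>i\<in>C. F ` ?B i)"
    using E(2)[OF borelN] FB C(1) by (intro emeasure_subadditive) (auto intro!: sets.countable_UN')
  also have "\<dots> = (\<integral>\<^sup>+i. emeasure lborel (F ` ?B i) \<partial>count_space C)"
    using N0 FB disjF C(1) by (simp add: emeasure_UN_countable)
  also have "\<dots> \<le> (\<integral>\<^sup>+i. ennreal r * emeasure lborel (?B i) \<partial>count_space C)"
    using le by (intro nn_integral_mono) auto
  also have "\<dots> = ennreal r * emeasure lborel (\<Union>i\<in>C. ?B i)"
    using disj C(1) by (simp add: emeasure_UN_countable nn_integral_cmult)
  also have "\<dots> \<le> ennreal r * emeasure lborel (E \<union> (O' - E))"
  proof (intro mult_left_mono emeasure_mono)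
    show "(\<Union>i\<in>C. ?B i) \<subseteq> E \<union> (O' - E)" using C(2) KO by blast
  qed (use O' E(1) in auto)
  also have "\<dots> \<le> ennreal r * (emeasure lborel E + emeasure lborel (O' - E))"
    using O' E(1) by (intro mult_left_mono emeasure_subadditive) auto
  also have "\<dots> \<le> ennreal r * (emeasure lborel E + ennreal (e / r))"
    using O' by (intro mult_left_mono add_left_mono) auto
  also have "\<dots> = ennreal r * emeasure lborel E + ennreal e"
    using r e by (simp add: distrib_left flip: ennreal_mult)
  finally show "emeasure lborel (F ` E) \<le> ennreal r * emeasure lborel E + ennreal e" .
qed

section \<open>Oscillation of difference quotients on null sets\<close>

text \<open>Only intervals strictly straddling the point and strict inequalities occur, which makes
  the condition at each scale open in \<open>x\<close> for continuous \<open>f\<close>. One-sided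
  quotients are recovered later by continuity.\<close>

definition oscillation_set :: "('a::real_normed_vector \<Rightarrow> real) \<Rightarrow> 'a \<Rightarrow> real \<Rightarrow> real \<Rightarrow> 'a set"
  where "oscillation_set f e r R = {x.
    (\<forall>d>0. \<exists>u v. u < 0 \<and> 0 < v \<and> v - u < d \<and> f (x + v *\<^sub>R e) - f (x + u *\<^sub>R e) < r * (v - u)) \<and>
    (\<forall>d>0. \<exists>u v. u < 0 \<and> 0 < v \<and> v - u < d \<and> R * (v - u) < f (x + v *\<^sub>R e) - f (x + u *\<^sub>R e))}"

text \<open>Restricting the scales to \<open>inverse (Suc n)\<close> writes the set as a countable
  intersection of open sets; the uncountable unions over \<open>u\<close> and \<open>v\<close>
  preserve openness.\<close>

lemma borel_oscillation_set:
  assumes f: "continuous_on UNIV f"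
  shows "oscillation_set f e r R \<in> sets borel"
proof -
  define P where "P n = {x. \<exists>u v. u < 0 \<and> 0 < v \<and> v - u < inverse (Suc n) \<and>
      f (x + v *\<^sub>R e) - f (x + u *\<^sub>R e) < r * (v - u)}" for n
  define Q where "Q n = {x. \<exists>u v. u < 0 \<and> 0 < v \<and> v - u < inverse (Suc n) \<and>
      R * (v - u) < f (x + v *\<^sub>R e) - f (x + u *\<^sub>R e)}" for n
  have "open {x. f (x + v *\<^sub>R e) - f (x + u *\<^sub>R e) < c}"
       "open {x. c < f (x + v *\<^sub>R e) - f (x + u *\<^sub>R e)}" for u v c
    by (intro open_Collect_less continuous_intros continuous_on_compose2[OF f]; simp)+
  then have "open (P n)" "open (Q n)" for n
    unfolding P_def Q_def
    by (intro open_Collect_ex open_Collect_conj open_Collect_const; simp)+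
  moreover have "oscillation_set f e r R = (\<Inter>n. P n \<inter> Q n)"
  proof (intro equalityI subsetI)
    fix x assume "x \<in> oscillation_set f e r R"
    then show "x \<in> (\<Inter>n. P n \<inter> Q n)"
      unfolding oscillation_set_def P_def Q_def by simp
  next
    fix x assume x: "x \<in> (\<Inter>n. P n \<inter> Q n)"
    show "x \<in> oscillation_set f e r R"
      unfolding oscillation_set_def
    proof (intro CollectI conjI allI impI)
      fix d :: real assume "d > 0"
      then obtain n where n: "inverse (Suc n) < d" using reals_Archimedean by blast
      have "x \<in> P n" "x \<in> Q n" using x by auto
      then show "\<exists>u v. u < 0 \<and> 0 < v \<and> v - u < d \<and> f (x + v *\<^sub>R e) - f (x + u *\<^sub>R e) < r * (v - u)"
        "\<exists>u v. u < 0 \<and> 0 < v \<and> v - u < d \<and> R * (v - u) < f (x + v *\<^sub>R e) - f (x + u *\<^sub>R e)"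
        using n unfolding P_def Q_def by (auto intro: less_trans)
    qed
  qed
  ultimately show ?thesis by auto
qed

text \<open>With \<open>F x = f x + (K + 1) * x\<close>, a bi-Lipschitz homeomorphism, and \<open>r' = r + K + 1\<close>,
  \<open>R' = R + K + 1\<close>, the covering estimate for \<open>F\<close> and for its inverse gives
  \<open>R' |E| \<le> |F E| \<le> r' |E|\<close> for bounded parts \<open>E\<close> of the set.\<close>

lemma null_oscillation_set_real:
  fixes f :: "real \<Rightarrow> real"
  assumes lip: "K-lipschitz_on UNIV f" and rR: "r < R"
  shows "emeasure lborel (oscillation_set f 1 r R) = 0"
proof -
  have K: "0 \<le> K" using lip by (rule lipschitz_on_nonneg)
  have fb: "\<bar>f y - f x\<bar> \<le> K * (y - x)" if "x \<le> y" for x y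
    using lipschitz_onD[OF lip, of y x] that by (simp add: dist_real_def)
  define F where "F x = f x + (K + 1) * x" for x
  have F1: "y - x \<le> F y - F x" and F2: "F y - F x \<le> (2 * K + 1) * (y - x)" if "x \<le> y" for x y
    using fb[OF that] that by (auto simp: F_def algebra_simps abs_le_iff)
  have smF: "strict_mono F"
  proof (rule strict_monoI)
    fix x y :: real assume "x < y"
    then show "F x < F y" using F1[of x y] by linarith
  qed
  have lipI: "C-lipschitz_on UNIV H" if "C \<ge> 0" "\<And>x y. x \<le> y \<Longrightarrow> \<bar>H y - H x\<bar> \<le> C * (y - x)"
    for C and H :: "real \<Rightarrow> real"
  proof (rule lipschitz_onI)
    fix x y show "dist (H x) (H y) \<le> C * dist x y"
      using that(2)[of x y] that(2)[of y x] by (cases "x \<le> y") (auto simp: dist_real_def)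
  qed (use that in auto)
  have lipF: "(2 * K + 1)-lipschitz_on UNIV F"
    using K F2 smF by (intro lipI) (auto simp: strict_mono_less_eq)
  have contF: "continuous_on UNIV F"
    using lipF by (rule lipschitz_on_continuous_on)
  have "\<exists>x. F x = y" for y
  proof -
    define m where "m = \<bar>y\<bar> + \<bar>F 0\<bar>"
    have "m \<ge> 0" by (simp add: m_def)
    have "F (- m) \<le> y" "y \<le> F m"
      using F1[of "-m" 0] F1[of 0 m] \<open>m \<ge> 0\<close> unfolding m_def by linarith+
    then show ?thesis
      using IVT'[of F "-m" y m] contF \<open>m \<ge> 0\<close> continuous_on_subset by fastforce
  qed
  then have surjF: "surj F" by (metis surjI)
  have injF: "inj F" using smF by (rule strict_mono_imp_inj_on)
  define G where "G = inv F"
  have GF: "G (F x) = x" and FG: "F (G x) = x" for x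
    using injF surjF by (auto simp: G_def surj_f_inv_f)
  have smG: "strict_mono G"
    by (rule strict_monoI) (metis FG smF strict_mono_less)
  have lipG: "1-lipschitz_on UNIV G"
  proof (rule lipI)
    fix x y :: real assume "x \<le> y"
    then have "G x \<le> G y" using smG by (simp add: strict_mono_less_eq)
    then show "\<bar>G y - G x\<bar> \<le> 1 * (y - x)" using F1[of "G x" "G y"] FG by simp
  qed auto
  have mF: "F \<in> borel_measurable borel" and mG: "G \<in> borel_measurable borel"
    using contF lipschitz_on_continuous_on[OF lipG] by (auto intro: borel_measurable_continuous_onI)
  have FA: "F ` A \<in> sets borel" and GA: "G ` A \<in> sets borel" if "A \<in> sets borel" for A
  proof -
    have "F ` A = G -` A" "G ` A = F -` A" using GF FG by (auto simp: image_iff) (metis FG GF)+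
    then show "F ` A \<in> sets borel" "G ` A \<in> sets borel"
      using measurable_sets[OF mF that] measurable_sets[OF mG that] by auto
  qed
  define r' where "r' = r + K + 1"
  define R' where "R' = R + K + 1"
  let ?E = "oscillation_set f 1 r R"
  have low: "\<exists>u v. u < 0 \<and> 0 < v \<and> v - u < d \<and> F (x + v) - F (x + u) < r' * (v - u)"
    and high: "\<exists>u v. u < 0 \<and> 0 < v \<and> v - u < d \<and> R' * (v - u) < F (x + v) - F (x + u)"
    if "x \<in> ?E" "d > 0" for x d
  proof -
    have "F (x + v) - F (x + u) < r' * (v - u) \<longleftrightarrow> f (x + v) - f (x + u) < r * (v - u)"
      "R' * (v - u) < F (x + v) - F (x + u) \<longleftrightarrow> R * (v - u) < f (x + v) - f (x + u)" for u v
      by (auto simp: r'_def R'_def F_def algebra_simps)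
    then show "\<exists>u v. u < 0 \<and> 0 < v \<and> v - u < d \<and> F (x + v) - F (x + u) < r' * (v - u)"
      "\<exists>u v. u < 0 \<and> 0 < v \<and> v - u < d \<and> R' * (v - u) < F (x + v) - F (x + u)"
      using that unfolding oscillation_set_def by simp_all
  qed
  show ?thesis
  proof (cases "?E = {}")
    case False
    then obtain x where "x \<in> ?E" by auto
    then obtain u v where uv: "u < 0" "0 < v" "F (x + v) - F (x + u) < r' * (v - u)"
      using low[of x 1] zero_less_one by blast
    \<comment> \<open>\<open>F\<close> has slope at least 1, so a slope below \<open>r'\<close>
      forces \<open>r' > 0\<close>, as the covering estimate requires.\<close>
    then have "0 < r' * (v - u)" using F1[of "x + u" "x + v"] by simp
    then have r': "r' > 0" using uv by (simp add: zero_less_mult_iff)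
    have R': "R' > r'" using rR by (simp add: r'_def R'_def)
    have "emeasure lborel (?E \<inter> {- real m..real m}) = 0" for m
    proof -
      let ?S = "?E \<inter> {- real m..real m}"
      have S: "?S \<in> sets borel"
        using borel_oscillation_set[OF lipschitz_on_continuous_on[OF lip]] by auto
      have le1: "emeasure lborel (F ` ?S) \<le> ennreal r' * emeasure lborel ?S"
      proof (rule emeasure_image_le_of_slopes[OF smF lipF S FA r'])
        fix x d :: real assume "x \<in> ?S" "0 < d"
        then obtain u v where uv: "u < 0" "0 < v" "v - u < d" "F (x + v) - F (x + u) < r' * (v - u)"
          using low by blast
        show "\<exists>a b. a < b \<and> b - a < d \<and> x \<in> {a..b} \<and> F b - F a \<le> r' * (b - a)"
          using uv by - (rule exI[where x = "x + u"], rule exI[where x = "x + v"], auto)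
      qed
      have le2: "emeasure lborel (G ` F ` ?S) \<le> ennreal (1 / R') * emeasure lborel (F ` ?S)"
      proof (rule emeasure_image_le_of_slopes[OF smG lipG FA[OF S] GA])
        fix y d :: real assume "y \<in> F ` ?S" and d: "0 < d"
        then obtain x where x: "y = F x" "x \<in> ?E" by auto
        \<comment> \<open>\<open>F\<close> stretches lengths by at most \<open>2 * K + 1\<close>, so
          this scale makes the image interval shorter than \<open>d\<close>.\<close>
        have d': "d / (2 * K + 1) > 0" using d K by simp
        then obtain u v where uv: "u < 0" "0 < v" "v - u < d / (2 * K + 1)"
            "R' * (v - u) < F (x + v) - F (x + u)"
          using high[OF x(2) d'] by blast
        have "F (x + v) - F (x + u) < d"
          using F2[of "x + u" "x + v"] uv K by (simp add: field_simps)
        moreover have "F (x + u) < F x" "F x < F (x + v)"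
          using smF uv by (auto simp: strict_mono_less)
        moreover have "v - u \<le> 1 / R' * (F (x + v) - F (x + u))"
          using uv R' r' by (simp add: field_simps)
        ultimately show "\<exists>a b. a < b \<and> b - a < d \<and> y \<in> {a..b} \<and> G b - G a \<le> 1 / R' * (b - a)"
          by - (rule exI[where x = "F (x + u)"], rule exI[where x = "F (x + v)"], simp add: GF x(1))
      qed (use R' r' in auto)
      have GFS: "G ` F ` ?S = ?S" by (auto simp: GF image_image)
      \<comment> \<open>The bounded window makes the measure a finite \<open>s\<close>, so that
        \<open>s \<le> r' / R' * s\<close> with \<open>r' < R'\<close> forces
        \<open>s = 0\<close>.\<close>
      have "emeasure lborel ?S \<le> emeasure lborel {- real m..real m}"
        by (intro emeasure_mono) auto
      then have "emeasure lborel ?S < \<infinity>" using order_le_less_trans by fastforce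
      then obtain s where s: "emeasure lborel ?S = ennreal s" "s \<ge> 0"
        by (cases "emeasure lborel ?S") auto
      have "ennreal s \<le> ennreal (1 / R') * (ennreal r' * ennreal s)"
        using le1 le2 GFS s by (metis (no_types, lifting) mult_left_mono order_trans zero_le)
      also have "\<dots> = ennreal (r' / R' * s)"
        using r' R' s by (simp add: ennreal_mult[symmetric] field_simps)
      finally have "s \<le> r' / R' * s"
        using s r' R' by (simp add: ennreal_le_iff)
      then have "(R' - r') * s \<le> 0" using r' R' by (simp add: field_simps)
      then have "s = 0" using R' s(2) by (simp add: mult_le_0_iff)
      then show ?thesis using s by simp
    qed
    then have "?E \<inter> {- real m..real m} \<in> null_sets lborel" for m
      using borel_oscillation_set[OF lipschitz_on_continuous_on[OF lip]] by (auto simp: null_sets_def)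
    then have "(\<Union>m. ?E \<inter> {- real m..real m}) \<in> null_sets lborel"
      by (rule null_sets_UN)
    moreover have "(\<Union>m. ?E \<inter> {- real m..real m}) = ?E"
    proof -
      have "\<exists>m. x \<in> {- real m..real m}" for x
        using real_arch_simple[of "\<bar>x\<bar>"] by (auto simp: abs_le_iff minus_le_iff)
      then show ?thesis by blast
    qed
    ultimately show ?thesis by (simp add: null_sets_def)
  qed simp
qed

lemma oscillation_set_line:
  "t \<in> oscillation_set (\<lambda>s. f (x + s *\<^sub>R e)) 1 r R \<longleftrightarrow> x + t *\<^sub>R e \<in> oscillation_set f e r R"
  by (simp add: oscillation_set_def scaleR_add_left add.assoc)

lemma lipschitz_on_line:
  fixes f :: "'a::real_normed_vector \<Rightarrow> 'b::metric_space"
  assumes "K-lipschitz_on UNIV f"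
  shows "(K * norm e)-lipschitz_on UNIV (\<lambda>t. f (x + t *\<^sub>R e))"
proof (rule lipschitz_onI)
  show "0 \<le> K * norm e" using lipschitz_on_nonneg[OF assms] by simp
  fix s t :: real
  have "dist (f (x + s *\<^sub>R e)) (f (x + t *\<^sub>R e)) \<le> K * dist (x + s *\<^sub>R e) (x + t *\<^sub>R e)"
    by (rule lipschitz_onD[OF assms]) auto
  also have "dist (x + s *\<^sub>R e) (x + t *\<^sub>R e) = norm e * dist s t"
    by (simp add: dist_norm flip: scaleR_diff_left)
  finally show "dist (f (x + s *\<^sub>R e)) (f (x + t *\<^sub>R e)) \<le> K * norm e * dist s t"
    by (simp add: mult.assoc)
qed

text \<open>Averaging over the translations \<open>t *\<^sub>R e\<close> with \<open>t \<in> {0..1}\<close> reduces the claim to lines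
  without choosing coordinates.\<close>

lemma null_oscillation_set:
  fixes f :: "'a::euclidean_space \<Rightarrow> real"
  assumes lip: "K-lipschitz_on UNIV f" and rR: "r < R"
  shows "oscillation_set f e r R \<in> null_sets lborel"
proof -
  define E where "E = oscillation_set f e r R"
  have [measurable]: "E \<in> sets borel"
    unfolding E_def by (rule borel_oscillation_set[OF lipschitz_on_continuous_on[OF lip]])
  let ?h = "\<lambda>(x::'a) (t::real). indicator {0..1} t * indicator E (t *\<^sub>R e + x) :: ennreal"
  have "(\<integral>\<^sup>+t. ?h x t \<partial>lborel) = 0" for x
  proof -
    \<comment> \<open>The line through \<open>x\<close> in direction \<open>e\<close> meets
      \<open>E\<close> in the oscillation set of the restricted function, which is null by the
      one-dimensional case.\<close>
    let ?O = "oscillation_set (\<lambda>s. f (x + s *\<^sub>R e)) 1 r R"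
    have O: "?O \<in> sets borel"
      by (rule borel_oscillation_set[OF lipschitz_on_continuous_on[OF lipschitz_on_line[OF lip]]])
    have "?h x t \<le> indicator ?O t" for t
      by (auto simp: E_def oscillation_set_line add.commute indicator_def)
    then have "(\<integral>\<^sup>+t. ?h x t \<partial>lborel) \<le> (\<integral>\<^sup>+t. indicator ?O t \<partial>lborel)"
      by (intro nn_integral_mono)
    also have "\<dots> = 0"
      using null_oscillation_set_real[OF lipschitz_on_line[OF lip] rR] O by simp
    finally show ?thesis by simp
  qed
  then have "0 = (\<integral>\<^sup>+x. (\<integral>\<^sup>+t. ?h x t \<partial>lborel) \<partial>lborel)" by simp
  \<comment> \<open>Tonelli; for fixed \<open>t\<close> the inner integral is the measure of
    \<open>E\<close>, by translation invariance.\<close>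
  also have "\<dots> = (\<integral>\<^sup>+t. (\<integral>\<^sup>+x. ?h x t \<partial>lborel) \<partial>lborel)"
    by (intro lborel_pair.Fubini'[symmetric]) measurable
  also have "\<dots> = (\<integral>\<^sup>+t. indicator {0..1::real} t * emeasure lborel E \<partial>lborel)"
  proof (intro nn_integral_cong)
    fix t :: real
    have "emeasure lborel E = (\<integral>\<^sup>+x. indicator E x \<partial>(distr lborel borel ((+) (t *\<^sub>R e))))"
      by (simp add: lborel_distr_plus)
    also have "\<dots> = (\<integral>\<^sup>+x. indicator E (t *\<^sub>R e + x) \<partial>lborel)"
      by (subst nn_integral_distr) auto
    finally show "(\<integral>\<^sup>+x. ?h x t \<partial>lborel) = indicator {0..1} t * emeasure lborel E"
      by (simp add: nn_integral_cmult)
  qed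
  also have "\<dots> = emeasure lborel E"
    by (simp add: nn_integral_multc)
  finally show ?thesis by (simp add: E_def[symmetric] null_sets_def)
qed

section \<open>From absence of oscillation to derivatives\<close>

text \<open>The straddling quotients converge to \<open>l\<close>, the supremum of the rates that
  bound them below at small scales: absence of oscillation between rational levels just above
  \<open>l\<close> turns every rate above \<open>l\<close> into an upper bound. One-sided quotients
  follow by letting the other endpoint tend to 0.\<close>

lemma field_differentiable_at_0_of_no_oscillation:
  fixes h :: "real \<Rightarrow> real"
  assumes lip: "K-lipschitz_on UNIV h"
    and no: "\<And>r R. r \<in> \<rat> \<Longrightarrow> R \<in> \<rat> \<Longrightarrow> r < R \<Longrightarrow> 0 \<notin> oscillation_set h 1 r R"
  shows "h field_differentiable (at 0)"
proof -
  define P where "P r \<longleftrightarrow> (\<exists>d>0. \<forall>u v. u < 0 \<and> 0 < v \<and> v - u < d \<longrightarrow> r * (v - u) \<le> h v - h u)" for r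
  define Q where "Q R \<longleftrightarrow> (\<exists>d>0. \<forall>u v. u < 0 \<and> 0 < v \<and> v - u < d \<longrightarrow> h v - h u \<le> R * (v - u))" for R
  have PQ: "P r \<or> Q R" if "r \<in> \<rat>" "R \<in> \<rat>" "r < R" for r R
    using no[OF that] unfolding oscillation_set_def P_def Q_def by simp (meson not_less)
  have fb: "\<bar>h y - h x\<bar> \<le> K * (y - x)" if "x \<le> y" for x y
    using lipschitz_onD[OF lip, of y x] that by (simp add: dist_real_def)
  have Pdown: "P r'" if "P r" "r' \<le> r" for r r'
  proof -
    have "r' * (v - u) \<le> r * (v - u)" if "u < 0" "0 < v" for u v :: real
      using that \<open>r' \<le> r\<close> by (intro mult_right_mono) auto
    then show ?thesis using that(1) unfolding P_def by (meson order_trans)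
  qed
  have Qup: "Q r'" if "Q r" "r \<le> r'" for r r'
  proof -
    have "r * (v - u) \<le> r' * (v - u)" if "u < 0" "0 < v" for u v :: real
      using that \<open>r \<le> r'\<close> by (intro mult_right_mono) auto
    then show ?thesis using that(1) unfolding Q_def by (meson order_trans)
  qed
  have "P (- K)"
    unfolding P_def
  proof (intro exI[of _ 1] conjI allI impI)
    fix u v :: real assume "u < 0 \<and> 0 < v \<and> v - u < 1"
    then show "- K * (v - u) \<le> h v - h u" using fb[of u v] by (simp add: abs_le_iff)
  qed simp
  have Pub: "r \<le> K" if Pr: "P r" for r
  proof -
    obtain d where d: "d > 0" "\<And>u v. u < 0 \<and> 0 < v \<and> v - u < d \<Longrightarrow> r * (v - u) \<le> h v - h u"
      using Pr unfolding P_def by blast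
    have "r * (d/4 - (-d/4)) \<le> h (d/4) - h (-d/4)" by (rule d(2)) (use d(1) in auto)
    also have "\<dots> \<le> K * (d/4 - (-d/4))"
      by (intro order_trans[OF abs_ge_self fb]) (use d(1) in auto)
    finally show ?thesis using d(1) by simp
  qed
  define l where "l = Sup (Collect P)"
  have bdd: "bdd_above (Collect P)" using Pub by (auto simp: bdd_above_def)
  have ne: "Collect P \<noteq> {}" using \<open>P (- K)\<close> by auto
  have Pl: "P (l - e)" if e: "e > 0" for e
  proof -
    obtain r where "P r" "l - e < r"
      using less_cSup_iff[OF ne bdd, of "l - e"] e unfolding l_def by auto
    then show ?thesis using Pdown by auto
  qed
  have Ql: "Q (l + e)" if e: "e > 0" for e
  proof -
    \<comment> \<open>\<open>P a\<close> fails because \<open>a\<close> exceeds the supremum, so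
      absence of oscillation between \<open>a\<close> and \<open>b\<close> gives
      \<open>Q b\<close>.\<close>
    obtain a where a: "a \<in> \<rat>" "l < a" "a < l + e/2" using Rats_dense_in_real[of l "l + e/2"] e by auto
    obtain b where b: "b \<in> \<rat>" "a < b" "b < a + e/2" using Rats_dense_in_real[of a "a + e/2"] e by auto
    have "\<not> P a" using cSup_upper[of a "Collect P"] bdd a unfolding l_def by auto
    then have "Q b" using PQ a b by blast
    then show ?thesis using Qup a b by fastforce
  qed
  have cont: "continuous_on UNIV h" using lip by (rule lipschitz_on_continuous_on)
  \<comment> \<open>A non-strict inequality valid just to one side of 0 persists at 0; this turns
    straddling estimates into one-sided ones.\<close>
  have left: "p 0 \<le> q 0" if "continuous_on UNIV p" "continuous_on UNIV q" "\<eta> > 0"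
      "\<And>u. - \<eta> < u \<Longrightarrow> u < 0 \<Longrightarrow> p u \<le> q u" for p q :: "real \<Rightarrow> real" and \<eta>
  proof (rule tendsto_le[OF trivial_limit_at_left_real])
    show "(p \<longlongrightarrow> p 0) (at_left 0)" "(q \<longlongrightarrow> q 0) (at_left 0)"
      using that(1,2) by (auto simp: continuous_on_def intro: tendsto_within_subset)
    show "\<forall>\<^sub>F u in at_left 0. p u \<le> q u"
      using that(3,4) unfolding eventually_at_left_field by (intro exI[of _ "-\<eta>"]) auto
  qed
  have right: "p 0 \<le> q 0" if "continuous_on UNIV p" "continuous_on UNIV q" "\<eta> > 0"
      "\<And>u. 0 < u \<Longrightarrow> u < \<eta> \<Longrightarrow> p u \<le> q u" for p q :: "real \<Rightarrow> real" and \<eta>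
  proof (rule tendsto_le[OF trivial_limit_at_right_real])
    show "(p \<longlongrightarrow> p 0) (at_right 0)" "(q \<longlongrightarrow> q 0) (at_right 0)"
      using that(1,2) by (auto simp: continuous_on_def intro: tendsto_within_subset)
    show "\<forall>\<^sub>F u in at_right 0. p u \<le> q u"
      using that(3,4) unfolding eventually_at_right_field by (intro exI[of _ "\<eta>"]) auto
  qed
  have "(h has_field_derivative l) (at 0)"
    unfolding has_field_derivative_iff
  proof (rule LIM_I)
    fix e :: real assume e: "e > 0"
    obtain d1 where d1: "d1 > 0"
        "\<And>u v. u < 0 \<Longrightarrow> 0 < v \<Longrightarrow> v - u < d1 \<Longrightarrow> (l - e/2) * (v - u) \<le> h v - h u"
      using Pl[of "e/2"] e unfolding P_def by auto
    obtain d2 where d2: "d2 > 0"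
        "\<And>u v. u < 0 \<Longrightarrow> 0 < v \<Longrightarrow> v - u < d2 \<Longrightarrow> h v - h u \<le> (l + e/2) * (v - u)"
      using Ql[of "e/2"] e unfolding Q_def by auto
    define d where "d = min d1 d2"
    have "norm ((h y - h 0) / (y - 0) - l) < e" if y: "y \<noteq> 0" "norm (y - 0) < d" for y
    proof -
      consider "y > 0" "y < d" | "y < 0" "- y < d" using y by (auto simp: abs_if split: if_splits)
      then have "(l - e/2) \<le> (h y - h 0) / y \<and> (h y - h 0) / y \<le> l + e/2"
      proof cases
        case 1
        \<comment> \<open>The estimate on \<open>{u..y}\<close> is passed to the limit in
          \<open>u\<close>; \<open>u > y - d\<close> keeps the interval shorter than
          \<open>d\<close>.\<close>
        have "(l - e/2) * (y - 0) \<le> h y - h 0"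
          by (rule left[where \<eta> = "d - y"])
            (use 1 d1 in \<open>auto simp: d_def intro!: continuous_intros cont\<close>)
        moreover have "h y - h 0 \<le> (l + e/2) * (y - 0)"
          by (rule left[where \<eta> = "d - y"])
            (use 1 d2 in \<open>auto simp: d_def intro!: continuous_intros cont\<close>)
        ultimately show ?thesis using 1 by (simp add: field_simps)
      next
        case 2
        have "(l - e/2) * (0 - y) \<le> h 0 - h y"
          by (rule right[where \<eta> = "d + y"])
            (use 2 d1 in \<open>auto simp: d_def intro!: continuous_intros cont\<close>)
        moreover have "h 0 - h y \<le> (l + e/2) * (0 - y)"
          by (rule right[where \<eta> = "d + y"])
            (use 2 d2 in \<open>auto simp: d_def intro!: continuous_intros cont\<close>)
        ultimately show ?thesis using 2 by (simp add: field_simps)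
      qed
      then show ?thesis using e by (auto simp: abs_less_iff)
    qed
    moreover have "d > 0" using d1 d2 by (simp add: d_def)
    ultimately show "\<exists>s>0. \<forall>y. y \<noteq> 0 \<and> norm (y - 0) < s \<longrightarrow> norm ((h y - h 0) / (y - 0) - l) < e"
      by blast
  qed
  then show ?thesis by (auto simp: field_differentiable_def)
qed

text \<open>The exceptional points lie in the union of the null oscillation sets for the countably
  many rational pairs of levels.\<close>

lemma lipschitz_AE_directional_derivative:
  fixes f :: "'a::euclidean_space \<Rightarrow> real"
  assumes lip: "K-lipschitz_on UNIV f"
  shows "AE x in lborel. (\<lambda>t. f (x + t *\<^sub>R e)) field_differentiable (at 0)"
proof -
  define I where "I = {(r, R). r \<in> \<rat> \<and> R \<in> \<rat> \<and> r < (R::real)}"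
  have "countable I"
    by (rule countable_subset[of _ "\<rat> \<times> \<rat>"]) (auto simp: I_def countable_rat)
  then have null: "(\<Union>i\<in>I. oscillation_set f e (fst i) (snd i)) \<in> null_sets lborel"
    by (rule null_sets_UN') (auto simp: I_def intro: null_oscillation_set[OF lip])
  show ?thesis
  proof (rule AE_I'[OF null], rule subsetI, rule ccontr)
    fix x assume "x \<in> {x \<in> space lborel. \<not> (\<lambda>t. f (x + t *\<^sub>R e)) field_differentiable (at 0)}"
      and x: "x \<notin> (\<Union>i\<in>I. oscillation_set f e (fst i) (snd i))"
    moreover have "(\<lambda>t. f (x + t *\<^sub>R e)) field_differentiable (at 0)"
      by (rule field_differentiable_at_0_of_no_oscillation[OF lipschitz_on_line[OF lip]])
        (use x in \<open>auto simp: I_def oscillation_set_line\<close>)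
    ultimately show False by simp
  qed
qed

lemma lipschitz_curve_AE_differentiable:
  fixes z :: "real \<Rightarrow> 'b::euclidean_space"
  assumes lip: "K-lipschitz_on UNIV z"
  shows "AE t in lborel. z differentiable (at t)"
proof -
  have "AE t in lborel. (\<lambda>s. z (t + s *\<^sub>R 1) \<bullet> i) field_differentiable (at 0)" if "i \<in> Basis" for i
  proof (rule lipschitz_AE_directional_derivative[where f = "\<lambda>t. z t \<bullet> i"])
    show "K-lipschitz_on UNIV (\<lambda>t. z t \<bullet> i)"
    proof (rule lipschitz_onI)
      fix x y
      have "dist (z x \<bullet> i) (z y \<bullet> i) \<le> dist (z x) (z y)"
        using Basis_le_norm[OF that, of "z x - z y"] by (simp add: dist_norm inner_diff_left)
      also have "\<dots> \<le> K * dist x y" using lipschitz_onD[OF lip] by simp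
      finally show "dist (z x \<bullet> i) (z y \<bullet> i) \<le> K * dist x y" .
    qed (use lipschitz_on_nonneg[OF lip] in auto)
  qed
  then have "AE t in lborel. \<forall>i\<in>Basis. (\<lambda>s. z (t + s *\<^sub>R 1) \<bullet> i) field_differentiable (at 0)"
    by (intro AE_ball_countable[THEN iffD2]) (auto intro: countable_finite)
  then show ?thesis
  proof (rule AE_mp, intro AE_I2 impI)
    fix t assume *: "\<forall>i\<in>Basis. (\<lambda>s. z (t + s *\<^sub>R 1) \<bullet> i) field_differentiable (at 0)"
    have "(\<lambda>s. z s \<bullet> i) differentiable (at t)" if "i \<in> Basis" for i
    proof -
      obtain l where "((\<lambda>s. z (t + s) \<bullet> i) has_field_derivative l) (at 0)"
        using bspec[OF * \<open>i \<in> Basis\<close>] unfolding field_differentiable_def by auto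
      then have "((\<lambda>s. z s \<bullet> i) has_field_derivative l) (at t)"
        using DERIV_shift[of "\<lambda>s. z s \<bullet> i" l 0 t] by (simp add: add.commute)
      then show ?thesis
        by (meson differentiable_def has_field_derivative_imp_has_derivative)
    qed
    then show "z differentiable (at t)"
      by (subst differentiable_componentwise_within) auto
  qed
qed

section \<open>Existence of Filippov solutions\<close>

text \<open>The secant slope is a weighted average of the slopes \<open>\<sigma> j\<close>, hence
  lies in \<open>C\<close>. A separating hyperplane replaces the explicit convex combination by a
  scalar inequality for one functional \<open>a\<close>.\<close>

lemma polygon_slope_mem:
  fixes y \<sigma> :: "int \<Rightarrow> 'b::euclidean_space"
  assumes h: "h > 0" and step: "\<And>j. y (j + 1) = y j + h *\<^sub>R \<sigma> j"
    and z: "\<And>t. z t = y \<lfloor>t / h\<rfloor> + (t - h * \<lfloor>t / h\<rfloor>) *\<^sub>R \<sigma> \<lfloor>t / h\<rfloor>"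
    and C: "closed C" "convex C" and st: "s < t"
    and \<sigma>: "\<And>j. \<lfloor>s / h\<rfloor> \<le> j \<Longrightarrow> j \<le> \<lfloor>t / h\<rfloor> \<Longrightarrow> \<sigma> j \<in> C"
  shows "(1 / (t - s)) *\<^sub>R (z t - z s) \<in> C"
proof (rule ccontr)
  assume "(1 / (t - s)) *\<^sub>R (z t - z s) \<notin> C"
  then obtain a b where ab: "a \<bullet> ((1 / (t - s)) *\<^sub>R (z t - z s)) < b" "\<forall>x\<in>C. b < a \<bullet> x"
    using separating_hyperplane_closed_point[OF C(2,1)] by blast
  define m where "m = \<lfloor>s / h\<rfloor>"
  define n where "n = \<lfloor>t / h\<rfloor>"
  have b: "b \<le> a \<bullet> \<sigma> j" if "m \<le> j" "j \<le> n" for j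
    using ab(2) \<sigma> that by (force simp: m_def n_def)
  have mn: "m \<le> n" using st h by (auto simp: m_def n_def intro!: floor_mono divide_right_mono)
  have bounds: "h * m \<le> s" "s \<le> h * (m + 1)" "h * n \<le> t"
    unfolding m_def n_def using h floor_divide_lower[OF h, of s] floor_divide_upper[OF h, of s]
      floor_divide_lower[OF h, of t] by (auto simp: mult.commute)
  have "b * (t - s) \<le> a \<bullet> (z t - z s)"
  proof (cases "m = n")
    case True
    then have "z t - z s = (t - s) *\<^sub>R \<sigma> n"
      unfolding z m_def[symmetric] n_def[symmetric] by (simp add: algebra_simps)
    then show ?thesis using b[of n] True st by (simp add: mult.commute mult_left_mono)
  next
    case False
    \<comment> \<open>Complete grid steps are summed by induction; the two incomplete steps at the
      ends are handled by \<open>slope\<close>.\<close>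
    have sum: "b * (h * (of_int k - of_int (m + 1))) \<le> a \<bullet> (y k - y (m + 1))" if "m + 1 \<le> k" "k \<le> n" for k
      using that
    proof (induction k rule: int_ge_induct)
      case (step k)
      then have "b * h \<le> (a \<bullet> \<sigma> k) * h" using b[of k] h by (intro mult_right_mono) auto
      moreover have "a \<bullet> y (k + 1) = a \<bullet> y k + h * (a \<bullet> \<sigma> k)"
        by (simp add: assms(2) inner_add_right)
      ultimately show ?case using step by (simp add: algebra_simps)
    qed simp
    have slope: "b * c \<le> a \<bullet> (c *\<^sub>R \<sigma> j)" if "m \<le> j" "j \<le> n" "0 \<le> c" for j c
      using mult_left_mono[OF b[OF that(1,2)] that(3)] by (simp add: mult.commute[of b c])
    have A: "b * (h * (of_int n - of_int (m + 1))) \<le> a \<bullet> (y n - y (m + 1))"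
      by (rule sum) (use mn False in auto)
    have B: "b * (t - h * n) \<le> a \<bullet> ((t - h * n) *\<^sub>R \<sigma> n)"
      using mn bounds by (intro slope) auto
    have C': "b * (h * (m + 1) - s) \<le> a \<bullet> ((h * (m + 1) - s) *\<^sub>R \<sigma> m)"
      using mn bounds by (intro slope) auto
    have eq: "z t - z s = (y n - y (m + 1)) + (t - h * n) *\<^sub>R \<sigma> n + (h * (m + 1) - s) *\<^sub>R \<sigma> m"
      unfolding z m_def[symmetric] n_def[symmetric] step by (simp add: algebra_simps)
    have "a \<bullet> (z t - z s) = a \<bullet> (y n - y (m + 1)) + a \<bullet> ((t - h * n) *\<^sub>R \<sigma> n)
        + a \<bullet> ((h * (m + 1) - s) *\<^sub>R \<sigma> m)"
      unfolding eq by (simp only: inner_add_right)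
    moreover have "b * (t - s) = b * (h * (of_int n - of_int (m + 1))) + b * (t - h * n) + b * (h * (m + 1) - s)"
      by (simp add: algebra_simps)
    ultimately show ?thesis using A B C' by linarith
  qed
  then have "b \<le> (a \<bullet> (z t - z s)) / (t - s)" using st by (simp add: field_simps)
  with ab(1) show False by simp
qed

text \<open>Only the secant property is exported, free of the grid. The margin \<open>h\<close> on
  both sides is there because the slope at a given time is sampled at an endpoint of its grid
  cell.\<close>

lemma euler_polygon:
  fixes \<phi> :: "'b::euclidean_space \<Rightarrow> 'b"
  assumes h: "h > 0"
  obtains z :: "real \<Rightarrow> 'b" where "z 0 = z0"
    "\<And>s t C. s < t \<Longrightarrow> closed C \<Longrightarrow> convex C \<Longrightarrow>
      (\<And>u. s - h \<le> u \<Longrightarrow> u \<le> t + h \<Longrightarrow> \<phi> (z u) \<in> C) \<Longrightarrow> (1 / (t - s)) *\<^sub>R (z t - z s) \<in> C"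
proof -
  define y :: "int \<Rightarrow> 'b" where "y j = (if 0 \<le> j then ((\<lambda>w. w + h *\<^sub>R \<phi> w) ^^ nat j) z0
      else ((\<lambda>w. w - h *\<^sub>R \<phi> w) ^^ nat (- j)) z0)" for j
  \<comment> \<open>For \<open>j < 0\<close> the step is computed backwards from
    \<open>y (j + 1)\<close>, so its slope is sampled at that right endpoint.\<close>
  define \<sigma> where "\<sigma> j = (if 0 \<le> j then \<phi> (y j) else \<phi> (y (j + 1)))" for j
  have step: "y (j + 1) = y j + h *\<^sub>R \<sigma> j" for j
  proof -
    consider "0 \<le> j" | "j = -1" | "j < -1" by linarith
    then show ?thesis
    proof cases
      case 1
      then have "nat (j + 1) = Suc (nat j)" by simp
      then show ?thesis using 1 by (simp add: y_def \<sigma>_def)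
    next
      case 3
      then have "nat (- j) = Suc (nat (- (j + 1)))" by simp
      then show ?thesis using 3 by (simp add: y_def \<sigma>_def)
    qed (simp add: y_def \<sigma>_def)
  qed
  define z where "z t = y \<lfloor>t / h\<rfloor> + (t - h * \<lfloor>t / h\<rfloor>) *\<^sub>R \<sigma> \<lfloor>t / h\<rfloor>" for t
  have zy: "z (h * of_int j) = y j" for j using h by (simp add: z_def)
  show ?thesis
  proof
    show "z 0 = z0" using zy[of 0] by (simp add: y_def)
    fix s t C assume st: "s < t" and C: "closed C" "convex C"
      and \<phi>: "\<And>u. s - h \<le> u \<Longrightarrow> u \<le> t + h \<Longrightarrow> \<phi> (z u) \<in> C"
    show "(1 / (t - s)) *\<^sub>R (z t - z s) \<in> C"
    proof (rule polygon_slope_mem[OF h step z_def C st])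
      fix j assume j: "\<lfloor>s / h\<rfloor> \<le> j" "j \<le> \<lfloor>t / h\<rfloor>"
      have "s / h < j + 1" "j \<le> t / h" using j by linarith+
      then have "s < h * of_int j + h" "h * of_int j \<le> t" using h by (auto simp: field_simps)
      then have "s - h \<le> h * of_int j" "h * of_int j \<le> t + h"
          "s - h \<le> h * of_int (j + 1)" "h * of_int (j + 1) \<le> t + h"
        using h by (auto simp: algebra_simps)
      then have "\<phi> (y j) \<in> C" "\<phi> (y (j + 1)) \<in> C"
        using \<phi>[of "h * of_int j"] \<phi>[of "h * of_int (j + 1)"] unfolding zy by blast+
      then show "\<sigma> j \<in> C" by (simp add: \<sigma>_def)
    qed
  qed
qed

section \<open>Nonempty Filippov values and limits of polygons\<close>

text \<open>Closed hulls have the finite intersection property inside a compact ball: finitely many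
  of them share the value of \<open>F\<close> at a point of \<open>D\<close> that lies in the
  smallest ball and outside the finitely many null sets.\<close>

lemma filippov_map_nonempty:
  fixes F :: "'b::euclidean_space \<Rightarrow> 'b"
  assumes r: "r > 0" and bound: "\<And>w. w \<in> D \<Longrightarrow> dist z w \<le> r \<Longrightarrow> norm (F w) \<le> K"
    and D: "\<And>\<delta>. \<delta> > 0 \<Longrightarrow> \<not> negligible (cball z \<delta> \<inter> D)"
  shows "\<exists>w\<in>filippov_map D F z. norm w \<le> K"
proof -
  let ?I = "{0<..} \<times> {S. negligible S} :: (real \<times> 'b set) set"
  let ?H = "\<lambda>i. closure (convex hull (F ` (cball z (fst i) \<inter> D - snd i)))"
  have "cball 0 K \<inter> (\<Inter>i\<in>?I. ?H i) \<noteq> {}"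
  proof (rule compact_imp_fip_image)
    fix J assume J: "finite J" "J \<subseteq> ?I"
    \<comment> \<open>Inserting \<open>r\<close> covers empty \<open>J\<close> and makes the bound
      on \<open>F\<close> available at the chosen point.\<close>
    define \<delta> where "\<delta> = Min (insert r (fst ` J))"
    have \<delta>: "\<delta> > 0" "\<delta> \<le> r" "\<And>i. i \<in> J \<Longrightarrow> \<delta> \<le> fst i"
      using J r by (auto simp: \<delta>_def)
    have "negligible (\<Union>(snd ` J))"
      using J by (intro negligible_Union) auto
    then obtain w where w: "w \<in> cball z \<delta> \<inter> D" "w \<notin> \<Union>(snd ` J)"
      using D[OF \<delta>(1)] negligible_subset by blast
    have "F w \<in> ?H i" if "i \<in> J" for i
    proof -
      have "w \<in> cball z (fst i) \<inter> D - snd i" using w that \<delta>(3)[OF that] by auto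
      then show ?thesis by (meson closure_subset hull_inc image_eqI subsetD)
    qed
    moreover have "F w \<in> cball 0 K" using bound w \<delta>(2) by auto
    ultimately show "cball 0 K \<inter> (\<Inter>i\<in>J. ?H i) \<noteq> {}" by blast
  qed auto
  then show ?thesis unfolding filippov_map_def by fastforce
qed

lemma filippov_mapD:
  "w \<in> filippov_map D F z \<Longrightarrow> \<delta> > 0 \<Longrightarrow> negligible S \<Longrightarrow>
    w \<in> closure (convex hull (F ` (cball z \<delta> \<inter> D - S)))"
  by (simp add: filippov_map_def)

text \<open>The conclusion concerns difference quotients at every \<open>t\<close> rather than
  derivatives at almost every \<open>t\<close>: the first form is what later yields a velocity at
  every time, and the second follows from it.\<close>

theorem filippov_existence:
  fixes F :: "'b::euclidean_space \<Rightarrow> 'b"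
  assumes r: "r > 0" and bound: "\<And>w. w \<in> D \<Longrightarrow> dist z0 w < r \<Longrightarrow> norm (F w) \<le> K"
    and D: "\<And>w \<delta>. dist z0 w < r \<Longrightarrow> \<delta> > 0 \<Longrightarrow> \<not> negligible (cball w \<delta> \<inter> D)"
  obtains \<epsilon> L z where "\<epsilon> > 0" "L-lipschitz_on UNIV z" "z 0 = z0"
    "\<And>t. \<bar>t\<bar> < \<epsilon> \<Longrightarrow> dist z0 (z t) < r"
    "\<And>t \<delta> S. \<bar>t\<bar> < \<epsilon> \<Longrightarrow> \<delta> > 0 \<Longrightarrow> negligible S \<Longrightarrow>
      \<forall>\<^sub>F s in at t. (1 / (s - t)) *\<^sub>R (z s - z t) \<in> closure (convex hull (F ` (cball (z t) \<delta> \<inter> D - S)))"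
proof -
  \<comment> \<open>The added 1 makes \<open>L\<close> positive, so that it can serve as a
    divisor.\<close>
  define L where "L = \<bar>K\<bar> + 1"
  have L: "L > 0" by (simp add: L_def)
  have "\<exists>y\<in>filippov_map D F w. norm y \<le> L" if w: "dist z0 w < r" for w
  proof (rule filippov_map_nonempty)
    show "(r - dist z0 w) / 2 > 0" using w by simp
    fix x assume x: "x \<in> D" "dist w x \<le> (r - dist z0 w) / 2"
    then have "dist z0 x < r" using dist_triangle[of z0 x w] w by simp
    then show "norm (F x) \<le> L" using bound x(1) by (force simp: L_def)
  qed (use D w in auto)
  then obtain \<phi>' where \<phi>': "\<And>w. dist z0 w < r \<Longrightarrow> \<phi>' w \<in> filippov_map D F w \<and> norm (\<phi>' w) \<le> L"
    by metis
  \<comment> \<open>Extension by 0 bounds the selection everywhere, so the polygons are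
    \<open>L\<close>-Lipschitz even where they leave the ball.\<close>
  define \<phi> where "\<phi> w = (if dist z0 w < r then \<phi>' w else 0)" for w
  have \<phi>_bound: "norm (\<phi> w) \<le> L" for w using \<phi>' L by (simp add: \<phi>_def)
  have \<phi>_mem: "\<phi> w \<in> filippov_map D F w" if "dist z0 w < r" for w using \<phi>' that by (simp add: \<phi>_def)
  define h where "h n = inverse (real (Suc n))" for n
  have "\<exists>z::real \<Rightarrow> 'b. z 0 = z0 \<and> (\<forall>s t C. s < t \<longrightarrow> closed C \<longrightarrow> convex C \<longrightarrow>
      (\<forall>u. s - h n \<le> u \<longrightarrow> u \<le> t + h n \<longrightarrow> \<phi> (z u) \<in> C) \<longrightarrow> (1 / (t - s)) *\<^sub>R (z t - z s) \<in> C)" for n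
    by (rule euler_polygon[of "h n" z0 \<phi>]) (auto simp: h_def)
  then obtain Z :: "nat \<Rightarrow> real \<Rightarrow> 'b" where Z0: "\<And>n. Z n 0 = z0"
    and Z: "\<And>n s t C. s < t \<Longrightarrow> closed C \<Longrightarrow> convex C \<Longrightarrow>
      (\<And>u. s - h n \<le> u \<Longrightarrow> u \<le> t + h n \<Longrightarrow> \<phi> (Z n u) \<in> C) \<Longrightarrow>
      (1 / (t - s)) *\<^sub>R (Z n t - Z n s) \<in> C"
    by metis
  have Zlip_less: "norm (Z n t - Z n s) \<le> L * (t - s)" if "s < t" for n s t
  proof -
    have "(1 / (t - s)) *\<^sub>R (Z n t - Z n s) \<in> cball 0 L"
      using \<phi>_bound by (intro Z that) auto
    then have "norm (Z n t - Z n s) / (t - s) \<le> L"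
      using that by (simp add: divide_inverse mult.commute)
    then show ?thesis using that by (simp add: pos_divide_le_eq)
  qed
  have Zlip: "norm (Z n t - Z n s) \<le> L * \<bar>t - s\<bar>" for n s t
    using Zlip_less[of s t n] Zlip_less[of t s n]
    by (cases s t rule: linorder_cases) (auto simp: norm_minus_commute)
  \<comment> \<open>Up to time \<open>\<epsilon>\<close> an \<open>L\<close>-Lipschitz curve moves
    at most \<open>r / 2\<close>; the other half is left for nearby polygon points.\<close>
  define \<epsilon> where "\<epsilon> = r / (2 * L)"
  have \<epsilon>: "\<epsilon> > 0" using r L by (simp add: \<epsilon>_def)
  let ?I = "{- \<epsilon>..\<epsilon>}"
  obtain g k where g: "continuous_on ?I g" "strict_mono (k :: nat \<Rightarrow> nat)"
      "\<And>e. 0 < e \<Longrightarrow> \<exists>N. \<forall>n x. n \<ge> N \<and> x \<in> ?I \<longrightarrow> norm (Z (k n) x - g x) < e"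
  proof (rule Arzela_Ascoli[of ?I Z "norm z0 + L * \<epsilon>"])
    fix n x assume x: "x \<in> ?I"
    have "norm (Z n x) \<le> norm z0 + norm (Z n x - Z n 0)"
      using norm_triangle_ineq[of z0 "Z n x - Z n 0"] by (simp add: Z0)
    also have "\<dots> \<le> norm z0 + L * \<epsilon>"
      using Zlip[of n x 0] x L by (intro add_left_mono order_trans[OF Zlip] mult_left_mono) auto
    finally show "norm (Z n x) \<le> norm z0 + L * \<epsilon>" .
  next
    fix x e :: real assume e: "0 < e"
    have "norm (Z n x - Z n y) < e" if "norm (x - y) < e / L" for n y
    proof -
      have "norm (Z n x - Z n y) \<le> L * \<bar>x - y\<bar>" by (rule Zlip)
      also have "\<dots> < e" using that L by (simp add: field_simps)
      finally show ?thesis .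
    qed
    then show "\<exists>d>0. \<forall>n y. y \<in> ?I \<and> norm (x - y) < d \<longrightarrow> norm (Z n x - Z n y) < e"
      using e L by (intro exI[of _ "e / L"]) auto
  qed auto
  have lim: "(\<lambda>n. Z (k n) t) \<longlonglongrightarrow> g t" if "t \<in> ?I" for t
    using g(3) that by (intro LIMSEQ_I) blast
  have glip: "norm (g t - g s) \<le> L * \<bar>t - s\<bar>" if "s \<in> ?I" "t \<in> ?I" for s t
  proof (rule tendsto_upperbound)
    show "(\<lambda>n. norm (Z (k n) t - Z (k n) s)) \<longlonglongrightarrow> norm (g t - g s)"
      using that by (intro tendsto_intros lim)
  qed (auto intro: always_eventually Zlip)
  \<comment> \<open>Constant continuation beyond \<open>?I\<close> gives a Lipschitz curve on the
    whole line.\<close>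
  define z where "z t = g (max (- \<epsilon>) (min \<epsilon> t))" for t
  have zg: "z t = g t" if "t \<in> ?I" for t using that by (simp add: z_def)
  have zlip: "norm (z t - z s) \<le> L * \<bar>t - s\<bar>" for s t
  proof -
    have "norm (z t - z s) \<le> L * \<bar>max (- \<epsilon>) (min \<epsilon> t) - max (- \<epsilon>) (min \<epsilon> s)\<bar>"
      unfolding z_def using \<epsilon> by (intro glip) auto
    also have "\<dots> \<le> L * \<bar>t - s\<bar>" using L by (intro mult_left_mono) auto
    finally show ?thesis .
  qed
  have z0: "z 0 = z0"
  proof -
    have "(\<lambda>n. Z (k n) 0) \<longlonglongrightarrow> g 0" using \<epsilon> by (intro lim) auto
    then have "g 0 = z0" using Z0 by (simp add: LIMSEQ_const_iff)
    then show ?thesis using zg[of 0] \<epsilon> by simp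
  qed
  have near: "dist z0 (z t) < r / 2" if "\<bar>t\<bar> < \<epsilon>" for t
  proof -
    have "dist z0 (z t) \<le> L * \<bar>t\<bar>" using zlip[of t 0] z0 by (simp add: dist_norm norm_minus_commute)
    also have "\<dots> < r / 2" using that L by (simp add: \<epsilon>_def field_simps)
    finally show ?thesis .
  qed
  have quot: "\<forall>\<^sub>F s in at t. (1 / (s - t)) *\<^sub>R (z s - z t) \<in> closure (convex hull (F ` (cball (z t) \<delta> \<inter> D - S)))"
    (is "\<forall>\<^sub>F s in at t. _ \<in> ?H") if t: "\<bar>t\<bar> < \<epsilon>" and \<delta>: "\<delta> > 0" and S: "negligible S" for t \<delta> S
  proof -
    define \<delta>' where "\<delta>' = min \<delta> (r / 2)"
    have \<delta>': "\<delta>' > 0" "\<delta>' \<le> \<delta>" "\<delta>' \<le> r / 2" using \<delta> r by (auto simp: \<delta>'_def)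
    \<comment> \<open>The quotients sample the selection at times within
      \<open>\<eta> + h (k n) < 2 * \<eta>\<close> of \<open>t\<close>. There a polygon has moved at
      most \<open>\<delta>' / 4\<close> from its value at \<open>t\<close>, which is within
      \<open>\<delta>' / 8\<close> of \<open>z t\<close>, so the total stays below
      \<open>\<delta>' / 2\<close>.\<close>
    define \<eta> where "\<eta> = min (\<epsilon> - \<bar>t\<bar>) (\<delta>' / (8 * L))"
    have \<eta>: "\<eta> > 0" "\<eta> \<le> \<epsilon> - \<bar>t\<bar>" "\<eta> \<le> \<delta>' / (8 * L)" using t \<delta>' L by (auto simp: \<eta>_def)
    have \<eta>L: "L * (2 * \<eta>) \<le> \<delta>' / 4" using \<eta>(3) L by (simp add: field_simps)
    have H: "closed ?H" "convex ?H" by (auto intro: convex_closure)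
    have tI: "t \<in> ?I" using t by auto
    obtain N1 where N1: "\<And>n x. n \<ge> N1 \<Longrightarrow> x \<in> ?I \<Longrightarrow> norm (Z (k n) x - g x) < \<delta>' / 8"
      using g(3)[of "\<delta>' / 8"] \<delta>' by auto
    obtain N2 where N2: "inverse (real (Suc N2)) < \<eta>" using reals_Archimedean[OF \<eta>(1)] by blast
    have hk: "h (k n) < \<eta>" if "n \<ge> N2" for n
    proof -
      have "n \<le> k n" using g(2) by (rule seq_suble)
      then have "h (k n) \<le> inverse (real (Suc N2))"
        unfolding h_def using that by (intro le_imp_inverse_le) auto
      then show ?thesis using N2 by simp
    qed
    have mem: "\<phi> (Z (k n) u) \<in> ?H" if "n \<ge> N1" "\<bar>u - t\<bar> \<le> 2 * \<eta>" for n u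
    proof -
      have "norm (Z (k n) u - Z (k n) t) \<le> \<delta>' / 4"
        using Zlip[of "k n" u t] that(2) L \<eta>L by (meson mult_left_mono order_trans less_imp_le)
      moreover have "norm (Z (k n) t - z t) < \<delta>' / 8" using N1[OF that(1) tI] zg[OF tI] by simp
      ultimately have d: "dist (Z (k n) u) (z t) < \<delta>' / 2"
        using norm_triangle_ineq[of "Z (k n) u - Z (k n) t" "Z (k n) t - z t"] \<delta>'(1)
        by (simp add: dist_norm)
      \<comment> \<open>This places the polygon point where \<open>\<phi>\<close> really selects
        from the Filippov map, not where it is 0 by default.\<close>
      have "dist z0 (Z (k n) u) < r"
        using d near[OF t] dist_triangle[of z0 "Z (k n) u" "z t"] \<delta>' r by (simp add: dist_commute)
      then have "\<phi> (Z (k n) u) \<in> filippov_map D F (Z (k n) u)" by (rule \<phi>_mem)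
      also have "\<dots> \<subseteq> closure (convex hull (F ` (cball (Z (k n) u) (\<delta>' / 2) \<inter> D - S)))"
        using \<delta>' S by (intro subsetI filippov_mapD) auto
      also have "\<dots> \<subseteq> ?H"
      proof (intro closure_mono hull_mono image_mono)
        have "dist (z t) x \<le> \<delta>" if "dist (Z (k n) u) x \<le> \<delta>' / 2" for x
          using that d dist_triangle[of "z t" x "Z (k n) u"] \<delta>' by (simp add: dist_commute)
        then show "cball (Z (k n) u) (\<delta>' / 2) \<inter> D - S \<subseteq> cball (z t) \<delta> \<inter> D - S" by auto
      qed
      finally show ?thesis .
    qed
    have "(1 / (s - t)) *\<^sub>R (z s - z t) \<in> ?H" if s: "s \<noteq> t" "dist s t < \<eta>" for s
    proof -
      have sI: "s \<in> ?I" using s \<eta> by (auto simp: dist_real_def)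
      have L1: "(\<lambda>n. (1 / (s - t)) *\<^sub>R (Z (k n) s - Z (k n) t)) \<longlonglongrightarrow> (1 / (s - t)) *\<^sub>R (z s - z t)"
        unfolding zg[OF sI] zg[OF tI] by (intro tendsto_intros lim sI tI)
      have L2: "\<forall>\<^sub>F n in sequentially. (1 / (s - t)) *\<^sub>R (Z (k n) s - Z (k n) t) \<in> ?H"
        unfolding eventually_sequentially
      proof (intro exI[of _ "max N1 N2"] allI impI)
        fix n assume n: "max N1 N2 \<le> n"
        have u: "\<phi> (Z (k n) u) \<in> ?H" if "min s t - h (k n) \<le> u" "u \<le> max s t + h (k n)" for u
          using n that s(2) hk[of n] by (intro mem) (auto simp: dist_real_def)
        show "(1 / (s - t)) *\<^sub>R (Z (k n) s - Z (k n) t) \<in> ?H"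
        proof (cases "s < t")
          case True
          have "(1 / (t - s)) *\<^sub>R (Z (k n) t - Z (k n) s) \<in> ?H"
            using True u by (intro Z True H) auto
          moreover have "(1 / (t - s)) *\<^sub>R (Z (k n) t - Z (k n) s) = (1 / (s - t)) *\<^sub>R (Z (k n) s - Z (k n) t)"
          proof -
            have "1 / (t - s) = - (1 / (s - t))" by (metis minus_diff_eq minus_divide_right)
            then show ?thesis by (simp only: scaleR_minus_left flip: scaleR_minus_right) simp
          qed
          ultimately show ?thesis by simp
        next
          case False
          then have "t < s" using s by simp
          then show ?thesis using u by (intro Z H) auto
        qed
      qed
      \<comment> \<open>The hull is closed, so membership passes from the polygons to their
        limit.\<close>
      show ?thesis by (rule Lim_in_closed_set[OF H(1) L2 sequentially_bot L1])
    qed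
    then show ?thesis using \<eta>(1) unfolding eventually_at by blast
  qed
  show ?thesis
  proof (rule that[OF \<epsilon> _ z0 _ quot])
    show "L-lipschitz_on UNIV z"
      using zlip L by (intro lipschitz_onI) (auto simp: dist_norm)
    show "dist z0 (z t) < r" if "\<bar>t\<bar> < \<epsilon>" for t using near[OF that] r by simp
  qed
qed

section \<open>Consequences of quotients lying in the hulls\<close>

lemma has_vector_derivative_iff_quotient:
  "(z has_vector_derivative w) (at t) \<longleftrightarrow> ((\<lambda>s. (1 / (s - t)) *\<^sub>R (z s - z t)) \<longlongrightarrow> w) (at t)"
proof -
  have "norm ((1 / (s - t)) *\<^sub>R (z s - z t) - w) = norm ((1 / norm (s - t)) *\<^sub>R (z s - (z t + (s - t) *\<^sub>R w)))"
    if "s \<noteq> t" for s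
  proof -
    have "(1 / (s - t)) *\<^sub>R (z s - z t) - w = (1 / (s - t)) *\<^sub>R (z s - (z t + (s - t) *\<^sub>R w))"
    proof -
      have "z s - (z t + (s - t) *\<^sub>R w) = (z s - z t) - (s - t) *\<^sub>R w" by simp
      then show ?thesis using that by (simp only: scaleR_diff_right) simp
    qed
    then show ?thesis by simp
  qed
  then have "((\<lambda>s. norm ((1 / (s - t)) *\<^sub>R (z s - z t) - w)) \<longlongrightarrow> 0) (at t) \<longleftrightarrow>
      ((\<lambda>s. norm ((1 / norm (s - t)) *\<^sub>R (z s - (z t + (s - t) *\<^sub>R w)))) \<longlongrightarrow> 0) (at t)"
    by (intro filterlim_cong refl) (auto simp: eventually_at_filter)
  then show ?thesis
    unfolding has_vector_derivative_def has_derivative_within tendsto_norm_zero_iff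
    by (simp add: bounded_linear_scaleR_left flip: LIM_zero_iff[of _ w])
qed

lemma lipschitz_absolutely_continuous_on:
  assumes lip: "L-lipschitz_on UNIV z"
  shows "absolutely_continuous_on I z"
  unfolding absolutely_continuous_on_def
proof (intro allI impI)
  fix \<epsilon> :: real assume \<epsilon>: "\<epsilon> > 0"
  have L: "L \<ge> 0" using lip by (rule lipschitz_on_nonneg)
  show "\<exists>\<delta>>0. \<forall>\<D>. \<D> division_of \<Union>\<D> \<and> \<Union>\<D> \<subseteq> I \<and> (\<Sum>K\<in>\<D>. Sup K - Inf K) < \<delta>
       \<longrightarrow> (\<Sum>K\<in>\<D>. norm (z (Sup K) - z (Inf K))) < \<epsilon>"
  \<comment> \<open>\<open>L + 1\<close> admits \<open>L = 0\<close> and makes the final inequality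
    strict.\<close>
  proof (intro exI[of _ "\<epsilon> / (L + 1)"] conjI allI impI)
    fix \<D> :: "real set set"
    assume D: "\<D> division_of \<Union>\<D> \<and> \<Union>\<D> \<subseteq> I \<and> (\<Sum>K\<in>\<D>. Sup K - Inf K) < \<epsilon> / (L + 1)"
    have le: "Inf K \<le> Sup K" if "K \<in> \<D>" for K
    proof -
      have "\<D> division_of \<Union>\<D>" using D by blast
      from division_ofD(4)[OF this that] division_ofD(3)[OF this that]
      obtain a b where "K = cbox a b" "K \<noteq> {}" by blast
      then show ?thesis by auto
    qed
    have "(\<Sum>K\<in>\<D>. norm (z (Sup K) - z (Inf K))) \<le> (\<Sum>K\<in>\<D>. L * (Sup K - Inf K))"
    proof (rule sum_mono)
      fix K assume "K \<in> \<D>"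
      then show "norm (z (Sup K) - z (Inf K)) \<le> L * (Sup K - Inf K)"
        using lipschitz_onD[OF lip, of "Sup K" "Inf K"] le[of K] by (simp add: dist_norm)
    qed
    also have "\<dots> = L * (\<Sum>K\<in>\<D>. Sup K - Inf K)" by (simp add: sum_distrib_left)
    also have "\<dots> \<le> L * (\<epsilon> / (L + 1))" using D L by (intro mult_left_mono) auto
    also have "\<dots> < \<epsilon>" using L \<epsilon> by (simp add: field_simps)
    finally show "(\<Sum>K\<in>\<D>. norm (z (Sup K) - z (Inf K))) < \<epsilon>" .
  qed (use \<epsilon> L in auto)
qed

text \<open>Where \<open>z\<close> is differentiable, hence almost everywhere, the derivative is a
  limit of quotients that eventually lie in each of the closed hulls whose intersection is the
  Filippov map.\<close>

lemma filippov_solution_of_quotients: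
  fixes F :: "'b::euclidean_space \<Rightarrow> 'b"
  assumes "\<epsilon> > 0" and lip: "L-lipschitz_on UNIV z"
    and U: "\<And>t. \<bar>t\<bar> < \<epsilon> \<Longrightarrow> z t \<in> U"
    and quot: "\<And>t \<delta> S. \<bar>t\<bar> < \<epsilon> \<Longrightarrow> \<delta> > 0 \<Longrightarrow> negligible S \<Longrightarrow>
      \<forall>\<^sub>F s in at t. (1 / (s - t)) *\<^sub>R (z s - z t) \<in> closure (convex hull (F ` (cball (z t) \<delta> \<inter> D - S)))"
  shows "filippov_solution U D F {- \<epsilon><..<\<epsilon>} z"
  unfolding filippov_solution_def
proof (intro conjI)
  show "\<exists>a\<in>{- \<epsilon><..<\<epsilon>}. \<exists>b\<in>{- \<epsilon><..<\<epsilon>}. a < b"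
    using assms(1) by (intro bexI[of _ 0] bexI[of _ "\<epsilon> / 2"]) auto
  show "z ` {- \<epsilon><..<\<epsilon>} \<subseteq> U" using U by (auto simp: abs_less_iff)
  have "AE t in lebesgue. z differentiable (at t)"
    by (rule AE_completion[OF lipschitz_curve_AE_differentiable[OF lip]])
  then show "AE t in lebesgue. t \<in> {- \<epsilon><..<\<epsilon>} \<longrightarrow>
      (\<exists>w\<in>filippov_map D F (z t). (z has_vector_derivative w) (at t within {- \<epsilon><..<\<epsilon>}))"
  proof (rule AE_mp, intro AE_I2 impI)
    fix t assume t: "t \<in> {- \<epsilon><..<\<epsilon>}" and "z differentiable (at t)"
    then obtain w where w: "(z has_vector_derivative w) (at t)" by (auto simp: vector_derivative_works)
    have "w \<in> filippov_map D F (z t)"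
      unfolding filippov_map_def
    proof (intro INT_I)
      fix \<delta> :: real and S :: "'b set" assume \<delta>: "\<delta> \<in> {0<..}" and S: "S \<in> {S. negligible S}"
      show "w \<in> closure (convex hull (F ` (cball (z t) \<delta> \<inter> D - S)))"
      proof (rule Lim_in_closed_set)
        show "((\<lambda>s. (1 / (s - t)) *\<^sub>R (z s - z t)) \<longlongrightarrow> w) (at t)"
          using w by (simp add: has_vector_derivative_iff_quotient)
      qed (use quot[of t \<delta> S] t \<delta> S in auto)
    qed
    then show "\<exists>w\<in>filippov_map D F (z t). (z has_vector_derivative w) (at t within {- \<epsilon><..<\<epsilon>})"
      using w has_vector_derivative_at_within by blast
  qed
qed (use lipschitz_absolutely_continuous_on[OF lip] in auto)

text \<open>Near \<open>z t\<close> the first component of the field is close to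
  \<open>snd (z t)\<close>. This confines the field to a closed convex cylinder, which therefore
  contains the hull and the quotients as well.\<close>

lemma second_order_velocity:
  fixes G :: "'b::euclidean_space \<times> 'b \<Rightarrow> 'b"
  assumes quot: "\<And>\<delta>. \<delta> > 0 \<Longrightarrow> \<forall>\<^sub>F s in at t. (1 / (s - t)) *\<^sub>R (z s - z t)
      \<in> closure (convex hull ((\<lambda>q. (snd q, G q)) ` (cball (z t) \<delta> \<inter> D)))"
  shows "((\<lambda>s. fst (z s)) has_vector_derivative snd (z t)) (at t)"
  unfolding has_vector_derivative_iff_quotient
proof (rule tendstoI)
  fix e :: real assume e: "e > 0"
  have sub: "closure (convex hull ((\<lambda>q. (snd q, G q)) ` (cball (z t) (e/2) \<inter> D))) \<subseteq> cball (snd (z t)) (e/2) \<times> UNIV"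
  proof (rule closure_minimal, rule hull_minimal)
    show "(\<lambda>q. (snd q, G q)) ` (cball (z t) (e/2) \<inter> D) \<subseteq> cball (snd (z t)) (e/2) \<times> UNIV"
    proof (intro image_subsetI)
      fix q assume "q \<in> cball (z t) (e/2) \<inter> D"
      then have "dist (snd (z t)) (snd q) \<le> e/2" using order_trans[OF dist_snd_le[of "z t" q], of "e/2"] by auto
      then show "(snd q, G q) \<in> cball (snd (z t)) (e/2) \<times> UNIV" by simp
    qed
  qed (auto intro!: convex_Times closed_Times)
  show "\<forall>\<^sub>F s in at t. dist ((1 / (s - t)) *\<^sub>R (fst (z s) - fst (z t))) (snd (z t)) < e"
    using quot[of "e/2"]
  proof (rule eventually_mono)
    fix s assume "(1 / (s - t)) *\<^sub>R (z s - z t)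
      \<in> closure (convex hull ((\<lambda>q. (snd q, G q)) ` (cball (z t) (e/2) \<inter> D)))"
    then have "fst ((1 / (s - t)) *\<^sub>R (z s - z t)) \<in> cball (snd (z t)) (e/2)"
      using subsetD[OF sub] unfolding mem_Times_iff by blast
    then show "dist ((1 / (s - t)) *\<^sub>R (fst (z s) - fst (z t))) (snd (z t)) < e"
      using e by (simp add: dist_commute)
  qed (use e in auto)
qed

section \<open>The geodesic vector field\<close>

text \<open>Composition with the nearest-point projection onto the closed ball, a 1-Lipschitz map,
  extends \<open>f\<close> globally with the same constant. Inside the open ball the extension
  agrees with \<open>f\<close> near each point, so it has the same partial derivatives
  there.\<close>

lemma lipschitz_negligible_not_has_partial:
  fixes f :: "real ^ 'n::finite \<Rightarrow> real"
  assumes \<rho>: "\<rho> > 0" and lip: "L-lipschitz_on (cball x0 \<rho>) f"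
  shows "negligible {x \<in> ball x0 \<rho>. \<not> has_partial f k x}"
proof -
  let ?c = "closest_point (cball x0 \<rho>)"
  have c: "?c x \<in> cball x0 \<rho>" for x using \<rho> by (intro closest_point_in_set) auto
  have lipc: "L-lipschitz_on UNIV (\<lambda>x. f (?c x))"
  proof (rule lipschitz_onI)
    fix x y
    have "dist (f (?c x)) (f (?c y)) \<le> L * dist (?c x) (?c y)" using lipschitz_onD[OF lip] c by blast
    also have "\<dots> \<le> L * dist x y"
      using \<rho> lipschitz_on_nonneg[OF lip] by (intro mult_left_mono closest_point_lipschitz) auto
    finally show "dist (f (?c x)) (f (?c y)) \<le> L * dist x y" .
  qed (rule lipschitz_on_nonneg[OF lip])
  have eq: "has_partial f k x" if x: "x \<in> ball x0 \<rho>"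
      and d: "(\<lambda>t. f (?c (x + t *\<^sub>R axis k 1))) field_differentiable (at 0)" for x
  proof -
    have "open ((\<lambda>t. x + t *\<^sub>R axis k 1) -` ball x0 \<rho>)" (is "open ?T")
      by (intro open_vimage continuous_intros) auto
    moreover have "0 \<in> ?T" using x by simp
    moreover have "f (?c (x + t *\<^sub>R axis k 1)) = f (x + t *\<^sub>R axis k 1)" if "t \<in> ?T" for t
      using that by (simp add: closest_point_self)
    ultimately show ?thesis
      using d unfolding has_partial_def field_differentiable_def
      by (meson has_field_derivative_transform_within_open)
  qed
  have "AE x in lebesgue. (\<lambda>t. f (?c (x + t *\<^sub>R axis k 1))) field_differentiable (at 0)"
    by (rule AE_completion[OF lipschitz_AE_directional_derivative[OF lipc]])
  then obtain N where N: "{x \<in> space lebesgue. \<not> (\<lambda>t. f (?c (x + t *\<^sub>R axis k 1))) field_differentiable (at 0)} \<subseteq> N"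
      "N \<in> null_sets lebesgue"
    by (rule AE_E3) auto
  have "negligible N" using N(2) by (simp add: negligible_iff_null_sets)
  then show ?thesis
    by (rule negligible_subset) (use N(1) eq in auto)
qed

lemma abs_partial_le_lipschitz:
  fixes f :: "real ^ 'n::finite \<Rightarrow> real"
  assumes lip: "L-lipschitz_on (ball x0 \<rho>) f" and x: "x \<in> ball x0 \<rho>" and p: "has_partial f k x"
  shows "\<bar>partial f k x\<bar> \<le> L"
proof -
  have "((\<lambda>t. f (x + t *\<^sub>R axis k 1)) has_field_derivative partial f k x) (at 0)"
    using p unfolding has_partial_def partial_def by (simp add: field_differentiable_derivI)
  then have "((\<lambda>t. (f (x + t *\<^sub>R axis k 1) - f x) / t) \<longlongrightarrow> partial f k x) (at 0)"
    by (simp add: has_field_derivative_iff)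
  then have lim: "((\<lambda>t. \<bar>(f (x + t *\<^sub>R axis k 1) - f x) / t\<bar>) \<longlongrightarrow> \<bar>partial f k x\<bar>) (at 0)"
    by (rule tendsto_rabs)
  have "open ((\<lambda>t. x + t *\<^sub>R axis k 1) -` ball x0 \<rho>)" (is "open ?T")
    by (intro open_vimage continuous_intros) auto
  then have "\<forall>\<^sub>F t in at 0. t \<in> ?T" using x by (intro eventually_at_in_open') auto
  moreover have "\<forall>\<^sub>F t in at 0. t \<noteq> (0::real)" by (simp add: eventually_at_filter)
  ultimately have "\<forall>\<^sub>F t in at 0. \<bar>(f (x + t *\<^sub>R axis k 1) - f x) / t\<bar> \<le> L"
  proof eventually_elim
    case (elim t)
    then have "\<bar>f (x + t *\<^sub>R axis k 1) - f x\<bar> \<le> L * \<bar>t\<bar>"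
      using lipschitz_onD[OF lip, of "x + t *\<^sub>R axis k 1" x] x
      by (simp add: dist_norm)
    then show ?case using elim by (simp add: divide_simps abs_mult)
  qed
  then show ?thesis by (rule tendsto_upperbound[OF lim]) simp
qed

text \<open>A Borel null superset makes the product a measurable rectangle, whose measure is 0 times
  infinity, that is, 0.\<close>

lemma negligible_Times_UNIV:
  fixes N :: "'a::euclidean_space set"
  assumes "negligible N"
  shows "negligible (N \<times> (UNIV :: 'b::euclidean_space set))"
proof -
  obtain N' where N': "N' \<in> null_sets lborel" "N \<subseteq> N'"
    using assms unfolding negligible_iff_null_sets null_sets_completion_iff2 by auto
  have "N' \<times> (UNIV :: 'b set) \<in> null_sets (lborel \<Otimes>\<^sub>M lborel)"
  proof -
    have "emeasure (lborel \<Otimes>\<^sub>M lborel) (N' \<times> (UNIV :: 'b set)) = emeasure lborel N' * emeasure lborel (UNIV :: 'b set)"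
      using N' by (intro lborel.emeasure_pair_measure_Times) auto
    then show ?thesis using N' by (auto simp: null_sets_def)
  qed
  then have "N' \<times> (UNIV :: 'b set) \<in> null_sets lborel" by (simp add: lborel_prod)
  then have "negligible (N' \<times> (UNIV :: 'b set))"
    by (simp add: negligible_iff_null_sets null_sets_completionI)
  then show ?thesis by (rule negligible_subset) (use N'(2) in auto)
qed

text \<open>Invertibility at \<open>x0\<close> gives a lower bound \<open>c\<close> for the matrix
  there. A perturbation of operator norm at most \<open>c / 2\<close> leaves the lower bound
  \<open>c / 2\<close>, so every column of the inverse has norm at most
  \<open>2 / c\<close>.\<close>

lemma matrix_inv_entries_bounded:
  fixes G :: "'a::metric_space \<Rightarrow> real ^ 'n ^ 'n::finite"
  assumes lip: "\<And>i j. L-lipschitz_on V (\<lambda>x. G x $ i $ j)" and "x0 \<in> V"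
    and inv: "\<And>x. x \<in> V \<Longrightarrow> invertible (G x)"
  obtains \<rho> C where "\<rho> > 0" "\<And>x i j. x \<in> V \<Longrightarrow> dist x0 x < \<rho> \<Longrightarrow> \<bar>matrix_inv (G x) $ i $ j\<bar> \<le> C"
proof -
  have "inj ((*v) (G x0))"
    using inv[OF \<open>x0 \<in> V\<close>] by (simp add: invertible_left_inverse matrix_left_invertible_injective)
  then obtain c where c: "c > 0" "\<And>u. c * norm u \<le> norm (G x0 *v u)"
    using linear_inj_bounded_below_pos[of "(*v) (G x0)"] by auto
  have L: "L \<ge> 0" using lip by (rule lipschitz_on_nonneg)
  define m where "m = real CARD('n) * real CARD('n)"
  have m: "m > 0" by (simp add: m_def)
  \<comment> \<open>Chosen so that \<open>m * (L * \<rho>) \<le> c / 2\<close>, where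
    \<open>m\<close> is the number of matrix entries; \<open>L + 1\<close> admits
    \<open>L = 0\<close>.\<close>
  define \<rho> where "\<rho> = c / (2 * m * (L + 1))"
  have \<rho>: "\<rho> > 0" using c m L by (simp add: \<rho>_def)
  show ?thesis
  proof (rule that[OF \<rho>])
    fix x i j assume x: "x \<in> V" "dist x0 x < \<rho>"
    have on: "onorm ((*v) (G x0 - G x)) \<le> m * (L * \<rho>)"
      unfolding m_def
    proof (rule onorm_le_matrix_component)
      fix i j
      have "\<bar>(G x0 - G x) $ i $ j\<bar> \<le> L * dist x0 x"
        using lipschitz_onD[OF lip \<open>x0 \<in> V\<close> x(1), of i j] by (simp add: dist_real_def)
      also have "\<dots> \<le> L * \<rho>" using x L by (intro mult_left_mono) auto
      finally show "\<bar>(G x0 - G x) $ i $ j\<bar> \<le> L * \<rho>" .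
    qed
    have "m * (L * \<rho>) = (L / (L + 1)) * (c / 2)" using m L by (simp add: \<rho>_def divide_simps)
    also have "\<dots> \<le> 1 * (c / 2)" using L c by (intro mult_right_mono) (auto simp: divide_simps)
    finally have on': "onorm ((*v) (G x0 - G x)) \<le> c / 2" using on by simp
    define u where "u = matrix_inv (G x) *v axis j 1"
    have "G x *v u = axis j 1"
      using someI_ex[OF inv[OF x(1), unfolded invertible_def]]
      by (simp add: u_def matrix_vector_mul_assoc matrix_inv_def)
    then have "norm (G x *v u) = 1" by simp
    moreover have "norm ((G x0 - G x) *v u) \<le> c / 2 * norm u"
      using onorm[OF matrix_vector_mul_bounded_linear, of "G x0 - G x" u] on'
      by (meson mult_right_mono norm_ge_zero order_trans)
    moreover have "norm (G x0 *v u) \<le> norm (G x *v u) + norm ((G x0 - G x) *v u)"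
      using norm_triangle_ineq[of "G x *v u" "(G x0 - G x) *v u"] by (simp add: matrix_vector_mult_diff_rdistrib)
    ultimately have "norm u \<le> 2 / c" using c(1) c(2)[of u] by (simp add: field_simps)
    moreover have "\<bar>matrix_inv (G x) $ i $ j\<bar> = \<bar>u $ i\<bar>"
      by (simp add: u_def matrix_vector_mult_basis column_def)
    ultimately show "\<bar>matrix_inv (G x) $ i $ j\<bar> \<le> 2 / c"
      using component_le_norm_cart[of u i] by linarith
  qed
qed

section \<open>Charts, tangent vectors and the metric matrix\<close>

lemma chart_inj_on:
  assumes "is_chart M c" shows "inj_on (snd c) (fst c)"
proof -
  have "homeomorphic_map (subtopology M (fst c)) (top_of_set (chart_image c)) (snd c)" and "fst c \<subseteq> topspace M"
    using assms openin_subset by (auto simp: is_chart_def)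
  then show ?thesis
    using homeomorphic_imp_injective_map by (fastforce simp: Int_absorb1)
qed

lemma chart_inv_chart:
  assumes "is_chart M c" "p \<in> fst c" shows "chart_inv c (snd c p) = p"
  unfolding chart_inv_def by (rule inv_into_f_f[OF chart_inj_on[OF assms(1)] assms(2)])

lemma open_chart_image_Int:
  assumes c: "is_chart M c" and W: "openin M W"
  shows "open (snd c ` (fst c \<inter> W))"
proof -
  have "open_map (subtopology M (fst c)) (top_of_set (chart_image c)) (snd c)"
    using c by (auto simp: is_chart_def intro: homeomorphic_imp_open_map)
  moreover have "openin (subtopology M (fst c)) (fst c \<inter> W)"
    using W by (auto simp: openin_subtopology)
  ultimately have "openin (top_of_set (chart_image c)) (snd c ` (fst c \<inter> W))"
    unfolding open_map_def by blast
  then show ?thesis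
    using c openin_open_trans by (auto simp: is_chart_def)
qed

context
  fixes M :: "'a topology" and A :: "('a, 'n::finite) chart set" and p :: 'a
  assumes M: "smooth_manifold M A"
begin

abbreviation coord_change :: "('a, 'n) chart \<Rightarrow> ('a, 'n) chart \<Rightarrow> real ^ 'n \<Rightarrow> real ^ 'n"
  where "coord_change c d \<equiv> frechet_derivative (transition c d) (at (snd c p))"

lemma charts_atD:
  assumes "c \<in> charts_at A p" shows "c \<in> A" "p \<in> fst c" "is_chart M c" "openin M (fst c)"
  using assms M by (auto simp: charts_at_def smooth_manifold_def is_chart_def)

lemma transition_has_derivative:
  assumes c: "c \<in> charts_at A p" and d: "d \<in> charts_at A p"
  shows "(transition c d has_derivative coord_change c d) (at (snd c p))"
proof -
  have "compatible c d" using M charts_atD[OF c] charts_atD[OF d] by (auto simp: smooth_manifold_def)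
  then have "Ck_on (Suc 0) (snd c ` (fst c \<inter> fst d)) (transition c d)"
    unfolding compatible_def smooth_on_def by blast
  then have "transition c d differentiable (at (snd c p))"
    using charts_atD[OF c] charts_atD[OF d] by auto
  then show ?thesis by (simp add: frechet_derivative_works)
qed

text \<open>Chain rule: on the image of the triple overlap, an open neighbourhood of
  \<open>snd c p\<close>, the transitions compose. This cocycle identity makes
  \<open>tangent_of\<close> yield genuine tangent vectors.\<close>

lemma coord_change_compose:
  assumes c: "c \<in> charts_at A p" and d: "d \<in> charts_at A p" and e: "e \<in> charts_at A p"
  shows "coord_change d e (coord_change c d u) = coord_change c e u"
proof -
  note C = charts_atD[OF c] and D = charts_atD[OF d] and E = charts_atD[OF e]
  have "snd d p = transition c d (snd c p)"
    using chart_inv_chart[OF C(3) C(2)] by (simp add: transition_def)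
  then have "(transition d e \<circ> transition c d has_derivative coord_change d e \<circ> coord_change c d) (at (snd c p))"
    using transition_has_derivative[OF c d] transition_has_derivative[OF d e] by (simp add: diff_chain_at)
  moreover have "open (snd c ` (fst c \<inter> (fst d \<inter> fst e)))" (is "open ?W")
    using open_chart_image_Int[OF C(3)] D(4) E(4) by blast
  moreover have "snd c p \<in> ?W" using C D E by auto
  moreover have "(transition d e \<circ> transition c d) x = transition c e x" if "x \<in> ?W" for x
    using that chart_inv_chart[OF C(3)] chart_inv_chart[OF D(3)] by (auto simp: transition_def)
  ultimately have "(transition c e has_derivative coord_change d e \<circ> coord_change c d) (at (snd c p))"
    by (rule has_derivative_transform_within_open)
  then show ?thesis
    using has_derivative_unique[OF _ transition_has_derivative[OF c e]] by (metis comp_apply)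
qed

lemma coord_change_self:
  assumes c: "c \<in> charts_at A p" shows "coord_change c c u = u"
proof -
  note C = charts_atD[OF c]
  have "open (snd c ` (fst c \<inter> fst c))" by (rule open_chart_image_Int[OF C(3,4)])
  moreover have "snd c p \<in> snd c ` (fst c \<inter> fst c)" using C by auto
  moreover have "id x = transition c c x" if "x \<in> snd c ` (fst c \<inter> fst c)" for x
    using that chart_inv_chart[OF C(3)] by (auto simp: transition_def)
  ultimately have "(transition c c has_derivative id) (at (snd c p))"
    using has_derivative_transform_within_open[OF has_derivative_id] by blast
  then show ?thesis
    using has_derivative_unique[OF _ transition_has_derivative[OF c c]] by (metis id_apply)
qed

lemma tangent_of_in_tangent_space:
  assumes c: "c \<in> charts_at A p" shows "tangent_of A c p u \<in> tangent_space A p"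
  using coord_change_compose[OF c] by (auto simp: tangent_of_def tangent_space_def)

text \<open>Together with \<open>coord_change_self\<close> this makes evaluation at \<open>c\<close>
  and \<open>tangent_of A c p\<close> mutually inverse, so that a chart identifies the tangent space
  with the coordinate space.\<close>

lemma tangent_of_coord:
  assumes c: "c \<in> charts_at A p" and "\<xi> \<in> tangent_space A p"
  shows "tangent_of A c p (\<xi> c) = \<xi>"
proof
  fix d
  show "tangent_of A c p (\<xi> c) d = \<xi> d"
  proof (cases "d \<in> charts_at A p")
    case True
    then have "\<xi> d = coord_change c d (\<xi> c)"
      using assms unfolding tangent_space_def by blast
    with True show ?thesis by (simp only: tangent_of_def if_True)
  next
    case False
    then have "\<xi> d = 0" using assms(2) unfolding tangent_space_def by blast
    with False show ?thesis by (simp only: tangent_of_def if_False)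
  qed
qed

lemma tangent_of_add:
  assumes c: "c \<in> charts_at A p"
  shows "tangent_of A c p (u + v) = (\<lambda>d. tangent_of A c p u d + tangent_of A c p v d)"
  using has_derivative_linear[OF transition_has_derivative[OF c]]
  by (auto simp: tangent_of_def linear_add)

lemma tangent_of_scaleR:
  assumes c: "c \<in> charts_at A p"
  shows "tangent_of A c p (a *\<^sub>R u) = (\<lambda>d. a *\<^sub>R tangent_of A c p u d)"
  using has_derivative_linear[OF transition_has_derivative[OF c]]
  by (auto simp: tangent_of_def linear_scale)

text \<open>\<open>symmetric_form\<close> gives linearity in the first argument, and symmetry
  carries it to the second; hence the arguments are swapped between the two expansions.\<close>

lemma form_eq_metric_comp:
  assumes c: "c \<in> charts_at A p" and sym: "symmetric_form (tangent_space A p) (g p)"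
  shows "g p (tangent_of A c p u) (tangent_of A c p w) = u \<bullet> (metric_comp A g c (snd c p) *v w)"
proof -
  let ?t = "tangent_of A c p"
  note T = tangent_of_in_tangent_space[OF c]
  have lin: "linear (\<lambda>u. g p (?t u) \<zeta>)" if "\<zeta> \<in> tangent_space A p" for \<zeta>
    using sym T that unfolding symmetric_form_def
    by (intro linearI) (simp_all add: tangent_of_add[OF c] tangent_of_scaleR[OF c])
  have expand: "g p (?t u) \<zeta> = (\<Sum>i\<in>UNIV. u $ i * g p (?t (axis i 1)) \<zeta>)"
    if "\<zeta> \<in> tangent_space A p" for u \<zeta>
  proof -
    have "u = (\<Sum>i\<in>UNIV. u $ i *\<^sub>R axis i 1)"
      using basis_expansion[of u] by (simp add: scalar_mult_eq_scaleR)
    then have "g p (?t u) \<zeta> = g p (?t (\<Sum>i\<in>UNIV. u $ i *\<^sub>R axis i 1)) \<zeta>" by simp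
    also have "\<dots> = (\<Sum>i\<in>UNIV. g p (?t (u $ i *\<^sub>R axis i 1)) \<zeta>)"
      by (rule linear_sum[OF lin[OF that]])
    also have "\<dots> = (\<Sum>i\<in>UNIV. u $ i * g p (?t (axis i 1)) \<zeta>)"
      using linear_scale[OF lin[OF that]] by simp
    finally show ?thesis .
  qed
  have symT: "g p (?t u) (?t v) = g p (?t v) (?t u)" for u v
    using sym T by (auto simp: symmetric_form_def)
  have "metric_comp A g c (snd c p) $ i $ j = g p (?t (axis i 1)) (?t (axis j 1))" for i j
    using chart_inv_chart[OF charts_atD(3,2)[OF c]] by (simp add: metric_comp_def)
  \<comment> \<open>The indices are transposed to match the swapped arguments below.\<close>
  then have comp: "metric_comp A g c (snd c p) $ i $ j = g p (?t (axis j 1)) (?t (axis i 1))" for i j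
    using symT by (rule trans)
  have "g p (?t u) (?t w) = (\<Sum>i\<in>UNIV. u $ i * g p (?t (axis i 1)) (?t w))"
    by (rule expand[OF T])
  also have "\<dots> = (\<Sum>i\<in>UNIV. u $ i * g p (?t w) (?t (axis i 1)))"
    by (intro sum.cong refl arg_cong2[where f = "(*)"] symT)
  also have "\<dots> = (\<Sum>i\<in>UNIV. u $ i * (\<Sum>j\<in>UNIV. w $ j * g p (?t (axis j 1)) (?t (axis i 1))))"
    by (intro sum.cong refl arg_cong2[where f = "(*)"] expand T)
  also have "\<dots> = u \<bullet> (metric_comp A g c (snd c p) *v w)"
    by (simp add: inner_vec_def matrix_vector_mult_def comp mult.commute)
  finally show ?thesis .
qed

text \<open>A kernel vector of the matrix represents a tangent vector orthogonal to the whole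
  tangent space. Nondegeneracy makes it vanish, and its coordinate vector in \<open>c\<close> is the
  kernel vector itself.\<close>

lemma invertible_metric_comp:
  assumes c: "c \<in> charts_at A p" and sym: "symmetric_form (tangent_space A p) (g p)"
    and nondeg: "nondegenerate_form (tangent_space A p) (g p)"
  shows "invertible (metric_comp A g c (snd c p))"
proof -
  have "w = 0" if w: "metric_comp A g c (snd c p) *v w = 0" for w
  proof -
    have "g p (tangent_of A c p w) \<eta> = 0" if \<eta>: "\<eta> \<in> tangent_space A p" for \<eta>
    proof -
      have "g p (tangent_of A c p w) \<eta> = g p (tangent_of A c p (\<eta> c)) (tangent_of A c p w)"
        using sym \<eta> tangent_of_in_tangent_space[OF c] tangent_of_coord[OF c \<eta>]
        by (simp add: symmetric_form_def)
      then show ?thesis using form_eq_metric_comp[OF c, of g, OF sym] w by simp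
    qed
    then have "tangent_of A c p w = (\<lambda>_. 0)"
      using nondeg tangent_of_in_tangent_space[OF c] by (simp add: nondegenerate_form_def)
    then have "tangent_of A c p w c = 0" by simp
    then show "w = 0" using c coord_change_self[OF c] by (simp add: tangent_of_def)
  qed
  then show ?thesis by (simp add: invertible_left_inverse matrix_left_invertible_ker)
qed

end

section \<open>Local bounds for Christoffel symbols and the geodesic field\<close>

lemma locally_lipschitz_uniform:
  fixes f :: "'i::finite \<Rightarrow> real ^ 'n \<Rightarrow> real"
  assumes "open V" "x0 \<in> V" and lip: "\<And>i. locally_lipschitz_on V (f i)"
  obtains \<rho> L where "\<rho> > 0" "cball x0 \<rho> \<subseteq> V" "\<And>i. L-lipschitz_on (cball x0 \<rho>) (f i)"
proof -
  obtain r where r: "r > 0" "cball x0 r \<subseteq> V" using assms(1,2) open_contains_cball by blast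
  have "\<exists>r l. r > 0 \<and> l-lipschitz_on (ball x0 r \<inter> V) (f i)" for i
    using lip[of i] \<open>x0 \<in> V\<close> unfolding locally_lipschitz_on_def by blast
  then obtain R l where R: "\<And>i. R i > 0" "\<And>i. (l i)-lipschitz_on (ball x0 (R i) \<inter> V) (f i)"
    by metis
  \<comment> \<open>Halving \<open>R i\<close> puts the closed ball inside the open ball on which
    \<open>f i\<close> is Lipschitz, and \<open>r\<close> keeps it in \<open>V\<close>.\<close>
  define \<rho> where "\<rho> = Min (insert r (range (\<lambda>i. R i / 2)))"
  have \<rho>: "\<rho> > 0" "\<rho> \<le> r" "\<rho> \<le> R i / 2" for i
  proof -
    show "\<rho> > 0" using r R(1) by (auto simp: \<rho>_def)
    show "\<rho> \<le> r" "\<rho> \<le> R i / 2" unfolding \<rho>_def by (rule Min_le; simp)+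
  qed
  have l: "l i \<le> (\<Sum>i\<in>UNIV. l i)" for i
    using lipschitz_on_nonneg[OF R(2)] by (intro member_le_sum) auto
  show ?thesis
  proof
    show "cball x0 \<rho> \<subseteq> V" using \<rho>(2) r(2) by (meson subset_cball subset_trans)
    show "(\<Sum>i\<in>UNIV. l i)-lipschitz_on (cball x0 \<rho>) (f i)" for i
    proof (rule lipschitz_on_mono[OF R(2)[of i] _ l])
      have "\<rho> < R i" using \<rho>(3)[of i] R(1)[of i] by simp
      then show "cball x0 \<rho> \<subseteq> ball x0 (R i) \<inter> V" using \<open>cball x0 \<rho> \<subseteq> V\<close> by auto
    qed
  qed (rule \<rho>(1))
qed

text \<open>On one ball the Lipschitz constant bounds the partial derivatives and uniform
  invertibility bounds the inverse entries. Points where some partial derivative is missing form a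
  finite union of null sets.\<close>

lemma christoffel_bounded:
  fixes c :: "('a, 'n::finite) chart"
  assumes V: "x0 \<in> chart_image c" "open (chart_image c)"
    and lip: "\<And>i j. locally_lipschitz_on (chart_image c) (\<lambda>x. metric_comp A g c x $ i $ j)"
    and inv: "\<And>x. x \<in> chart_image c \<Longrightarrow> invertible (metric_comp A g c x)"
  obtains \<rho> B where "\<rho> > 0" "ball x0 \<rho> \<subseteq> chart_image c"
    "\<And>i j k x. x \<in> ball x0 \<rho> \<inter> christoffel_dom A g c \<Longrightarrow> \<bar>christoffel A g c i j k x\<bar> \<le> B"
    "negligible (ball x0 \<rho> - christoffel_dom A g c)"
proof -
  let ?G = "metric_comp A g c"
  \<comment> \<open>Indexing the components by pairs turns them into a single finite family.\<close>
  obtain \<rho>1 L where \<rho>1: "\<rho>1 > 0" "cball x0 \<rho>1 \<subseteq> chart_image c"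
      and L: "\<And>i. L-lipschitz_on (cball x0 \<rho>1) (\<lambda>x. ?G x $ fst i $ snd i)"
    using locally_lipschitz_uniform[OF V(2,1), of "\<lambda>i x. ?G x $ fst i $ snd i"] lip by metis
  have L: "L-lipschitz_on (cball x0 \<rho>1) (\<lambda>x. ?G x $ i $ j)" for i j
    using L[of "(i, j)"] by simp
  obtain \<rho>2 C where \<rho>2: "\<rho>2 > 0"
      "\<And>x i j. x \<in> cball x0 \<rho>1 \<Longrightarrow> dist x0 x < \<rho>2 \<Longrightarrow> \<bar>matrix_inv (?G x) $ i $ j\<bar> \<le> C"
    using matrix_inv_entries_bounded[of L "cball x0 \<rho>1" ?G x0] L \<rho>1 inv
    by (metis centre_in_cball less_imp_le subsetD)
  define \<rho> where "\<rho> = min \<rho>1 \<rho>2"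
  have L0: "L \<ge> 0" using L by (rule lipschitz_on_nonneg)
  show ?thesis
  proof (rule that)
    show "\<rho> > 0" using \<rho>1 \<rho>2 by (simp add: \<rho>_def)
    show "ball x0 \<rho> \<subseteq> chart_image c" using \<rho>1(2) by (auto simp: \<rho>_def subset_eq)
    show "negligible (ball x0 \<rho> - christoffel_dom A g c)"
    proof (rule negligible_subset)
      show "negligible (\<Union>i. \<Union>j. \<Union>k. {x \<in> ball x0 \<rho>1. \<not> has_partial (\<lambda>y. ?G y $ i $ j) k x})"
        using lipschitz_negligible_not_has_partial[OF \<rho>1(1) L]
        by (intro negligible_Union) (auto intro!: negligible_Union)
      show "ball x0 \<rho> - christoffel_dom A g c
          \<subseteq> (\<Union>i. \<Union>j. \<Union>k. {x \<in> ball x0 \<rho>1. \<not> has_partial (\<lambda>y. ?G y $ i $ j) k x})"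
        using \<open>ball x0 \<rho> \<subseteq> chart_image c\<close> by (auto simp: christoffel_dom_def \<rho>_def)
    qed
    fix i j k x assume x: "x \<in> ball x0 \<rho> \<inter> christoffel_dom A g c"
    have p: "\<bar>partial (\<lambda>y. ?G y $ a $ b) k x\<bar> \<le> L" for a b k
      using x lipschitz_on_subset[OF L ball_subset_cball]
      by (intro abs_partial_le_lipschitz[of L x0 \<rho>1]) (auto simp: \<rho>_def christoffel_dom_def)
    have m: "\<bar>matrix_inv (?G x) $ a $ b\<bar> \<le> C" for a b
      using x by (intro \<rho>2(2)) (auto simp: \<rho>_def)
    have "\<bar>christoffel A g c i j k x\<bar> \<le> 1/2 * (\<Sum>l\<in>(UNIV::'n set). C * (3 * L))"
      unfolding christoffel_def abs_mult
    proof (intro mult_mono order_trans[OF sum_abs] sum_mono)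
      fix l
      let ?q = "partial (\<lambda>y. ?G y $ l $ k) j x + partial (\<lambda>y. ?G y $ l $ j) k x - partial (\<lambda>y. ?G y $ j $ k) l x"
      have "\<bar>?q\<bar> \<le> 3 * L" using p[of l k j] p[of l j k] p[of j k l] by linarith
      moreover have "0 \<le> C" using m[of i l] by linarith
      ultimately show "\<bar>matrix_inv (?G x) $ i $ l * ?q\<bar> \<le> C * (3 * L)"
        unfolding abs_mult using m by (intro mult_mono) auto
    qed auto
    then show "\<bar>christoffel A g c i j k x\<bar> \<le> 1/2 * (\<Sum>l\<in>(UNIV::'n set). C * (3 * L))" .
  qed
qed

text \<open>In the cube of the dimension one factor comes from bounding the Euclidean norm by the
  sum of the absolute components, the other two from the double sum.\<close>

lemma norm_geodesic_field_le:
  fixes c :: "('a, 'n::finite) chart"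
  assumes "\<And>i j k. \<bar>christoffel A g c i j k x\<bar> \<le> B"
  shows "norm (geodesic_field A g c (x, v)) \<le> norm v + real CARD('n) ^ 3 * B * norm v ^ 2"
proof -
  have "0 \<le> B" using assms[of undefined undefined undefined] by linarith
  let ?a = "\<chi> i. - (\<Sum>j\<in>UNIV. \<Sum>k\<in>UNIV. christoffel A g c i j k x * v $ j * v $ k)"
  have "\<bar>?a $ i\<bar> \<le> (\<Sum>j\<in>(UNIV::'n set). \<Sum>k\<in>(UNIV::'n set). B * norm v * norm v)" for i
    unfolding vec_lambda_beta abs_minus_cancel
  proof (intro order_trans[OF sum_abs] sum_mono)
    fix j k
    show "\<bar>christoffel A g c i j k x * v $ j * v $ k\<bar> \<le> B * norm v * norm v"
      unfolding abs_mult using assms \<open>0 \<le> B\<close> by (intro mult_mono component_le_norm_cart) auto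
  qed
  then have "norm ?a \<le> (\<Sum>i\<in>(UNIV::'n set). \<Sum>j\<in>(UNIV::'n set). \<Sum>k\<in>(UNIV::'n set). B * norm v * norm v)"
    by (intro order_trans[OF norm_le_l1_cart] sum_mono)
  also have "\<dots> = real CARD('n) ^ 3 * B * norm v ^ 2"
    by (simp add: power2_eq_square power3_eq_cube)
  finally show ?thesis
    using norm_Pair_le[of v ?a] by (simp add: geodesic_field_def)
qed

section \<open>Existence of continuously differentiable Filippov geodesics\<close>

theorem filippov_geodesic_existence:
  fixes c :: "('a, 'n::finite) chart"
  assumes V: "x0 \<in> chart_image c" "open (chart_image c)"
    and lip: "\<And>i j. locally_lipschitz_on (chart_image c) (\<lambda>x. metric_comp A g c x $ i $ j)"
    and inv: "\<And>x. x \<in> chart_image c \<Longrightarrow> invertible (metric_comp A g c x)"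
  shows "\<exists>\<epsilon>>0. \<exists>x. filippov_geodesic A g c {-\<epsilon><..<\<epsilon>} x \<and>
      x C1_differentiable_on {-\<epsilon><..<\<epsilon>} \<and> x 0 = x0 \<and> (x has_vector_derivative v0) (at 0)"
proof -
  obtain \<rho> B where \<rho>: "\<rho> > 0" "ball x0 \<rho> \<subseteq> chart_image c"
      and B: "\<And>i j k x. x \<in> ball x0 \<rho> \<inter> christoffel_dom A g c \<Longrightarrow> \<bar>christoffel A g c i j k x\<bar> \<le> B"
      and N: "negligible (ball x0 \<rho> - christoffel_dom A g c)"
    using christoffel_bounded[OF V lip inv] by blast
  \<comment> \<open>\<open>\<rho>\<close> keeps positions in the good ball; 1 limits the velocity,
    in which the field is quadratic.\<close>
  define r where "r = min \<rho> 1"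
  define D where "D = christoffel_dom A g c \<times> (UNIV :: (real ^ 'n) set)"
  have in_ball: "fst w \<in> ball x0 \<rho>" "norm (snd w) \<le> norm v0 + 1" if "dist (x0, v0) w < r" for w
  proof -
    have "dist x0 (fst w) < r" "dist v0 (snd w) < r"
      using dist_fst_le[of "(x0, v0)" w] dist_snd_le[of "(x0, v0)" w] that by simp_all
    then show "fst w \<in> ball x0 \<rho>" "norm (snd w) \<le> norm v0 + 1"
      using norm_triangle_ineq2[of "snd w" v0] by (auto simp: r_def dist_norm norm_minus_commute)
  qed
  have bound: "norm (geodesic_field A g c w) \<le> (norm v0 + 1) + real CARD('n) ^ 3 * \<bar>B\<bar> * (norm v0 + 1) ^ 2"
    if "w \<in> D" "dist (x0, v0) w < r" for w
  proof -
    \<comment> \<open>\<open>\<bar>B\<bar>\<close> provides the nonnegative coefficient for the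
      monotonicity estimate below.\<close>
    have "\<bar>christoffel A g c i j k (fst w)\<bar> \<le> \<bar>B\<bar>" for i j k
    proof -
      have "\<bar>christoffel A g c i j k (fst w)\<bar> \<le> B"
        using in_ball(1)[OF that(2)] that(1) by (intro B) (auto simp: D_def)
      then show ?thesis by linarith
    qed
    then have "norm (geodesic_field A g c (fst w, snd w)) \<le> norm (snd w) + real CARD('n) ^ 3 * \<bar>B\<bar> * norm (snd w) ^ 2"
      by (rule norm_geodesic_field_le)
    also have "\<dots> \<le> (norm v0 + 1) + real CARD('n) ^ 3 * \<bar>B\<bar> * (norm v0 + 1) ^ 2"
      using in_ball(2)[OF that(2)] by (intro add_mono mult_left_mono power_mono) auto
    finally show ?thesis by simp
  qed
  have full: "\<not> negligible (cball w \<delta> \<inter> D)" if w: "dist (x0, v0) w < r" and \<delta>: "\<delta> > 0" for w \<delta>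
  proof
    assume "negligible (cball w \<delta> \<inter> D)"
    moreover have "negligible ((ball x0 \<rho> - christoffel_dom A g c) \<times> (UNIV :: (real ^ 'n) set))"
      using N by (rule negligible_Times_UNIV)
    ultimately have "negligible (cball w \<delta> \<inter> D \<union> (ball x0 \<rho> - christoffel_dom A g c) \<times> UNIV)"
      by (rule negligible_Un)
    \<comment> \<open>If \<open>D\<close> were null near \<open>w\<close>, this nonempty open set
      would be covered by two null sets.\<close>
    moreover have "ball w \<delta> \<inter> ball (x0, v0) r \<subseteq> cball w \<delta> \<inter> D \<union> (ball x0 \<rho> - christoffel_dom A g c) \<times> UNIV"
      using in_ball(1) by (fastforce simp: D_def mem_Times_iff)
    ultimately have "negligible (ball w \<delta> \<inter> ball (x0, v0) r)" by (rule negligible_subset)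
    moreover have "w \<in> ball w \<delta> \<inter> ball (x0, v0) r" using w \<delta> by simp
    ultimately show False using open_not_negligible[of "ball w \<delta> \<inter> ball (x0, v0) r"] by blast
  qed
  have "r > 0" using \<rho> by (simp add: r_def)
  from filippov_existence[of r D "(x0, v0)" "geodesic_field A g c", OF this bound full]
  obtain \<epsilon> L z where \<epsilon>: "\<epsilon> > 0" and z: "L-lipschitz_on UNIV z" "z 0 = (x0, v0)"
      "\<And>t. \<bar>t\<bar> < \<epsilon> \<Longrightarrow> dist (x0, v0) (z t) < r"
      and quot: "\<And>t \<delta> S. \<bar>t\<bar> < \<epsilon> \<Longrightarrow> \<delta> > 0 \<Longrightarrow> negligible S \<Longrightarrow>
        \<forall>\<^sub>F s in at t. (1 / (s - t)) *\<^sub>R (z s - z t)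
          \<in> closure (convex hull (geodesic_field A g c ` (cball (z t) \<delta> \<inter> D - S)))"
    by blast
  let ?I = "{- \<epsilon><..<\<epsilon>}"
  have "filippov_solution (chart_image c \<times> UNIV) D (geodesic_field A g c) ?I z"
    using in_ball(1)[OF z(3)] \<rho>(2)
    by (intro filippov_solution_of_quotients[OF \<epsilon> z(1) _ quot]) (auto simp: mem_Times_iff)
  then have "filippov_geodesic A g c ?I (\<lambda>t. fst (z t))"
    unfolding filippov_geodesic_def D_def by (intro exI[of _ "\<lambda>t. snd (z t)"]) simp
  moreover have der: "((\<lambda>t. fst (z t)) has_vector_derivative snd (z t)) (at t)" if "\<bar>t\<bar> < \<epsilon>" for t
  proof (rule second_order_velocity)
    fix \<delta> :: real assume "\<delta> > 0"
    \<comment> \<open>The field is put in the form with first component \<open>snd q\<close>; the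
      empty set serves as the null set.\<close>
    have eq: "geodesic_field A g c = (\<lambda>q. (snd q, snd (geodesic_field A g c q)))"
      by (auto simp: geodesic_field_def)
    then show "\<forall>\<^sub>F s in at t. (1 / (s - t)) *\<^sub>R (z s - z t)
        \<in> closure (convex hull ((\<lambda>q. (snd q, snd (geodesic_field A g c q))) ` (cball (z t) \<delta> \<inter> D)))"
      using quot[OF that \<open>\<delta> > 0\<close> negligible_empty] by (simp only: eq[symmetric] Diff_empty)
  qed
  moreover have "continuous_on ?I (\<lambda>t. snd (z t))"
    using lipschitz_on_continuous_on[OF z(1)]
    by (intro continuous_on_snd) (rule continuous_on_subset, auto)
  moreover have "(\<lambda>t. fst (z t)) C1_differentiable_on ?I"
    \<comment> \<open>\<open>calculation(3)\<close> is the continuity of the velocity, collected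
      just above.\<close>
    unfolding C1_differentiable_on_def using der calculation(3)
    by (intro exI[of _ "\<lambda>t. snd (z t)"]) (auto simp: abs_less_iff)
  ultimately show ?thesis
    using \<epsilon> z(2) der[of 0] by (intro exI[of _ \<epsilon>] conjI exI[of _ "\<lambda>t. fst (z t)"]) auto
qed

text \<open>Existence is given in initial value form: prescribing a nonzero velocity excludes the
  trivial solutions that are constant curves.\<close>

theorem theorem2:
  fixes M :: "'a topology" and A :: "('a, 'n::finite) chart set" and g :: "('a, 'n) tensor02"
  assumes "smooth_manifold M A"
    and "lipschitz_semi_riemannian_metric M A g"
  shows "\<forall>p\<in>topspace M. \<forall>\<xi>\<in>tangent_space A p. \<forall>c\<in>charts_at A p.
    \<exists>\<epsilon>>0. \<exists>x. filippov_geodesic A g c {-\<epsilon><..<\<epsilon>} x \<and>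
      x C1_differentiable_on {-\<epsilon><..<\<epsilon>} \<and>
      x 0 = snd c p \<and> (x has_vector_derivative \<xi> c) (at 0)"
proof (intro ballI)
  fix p \<xi> c assume c: "c \<in> charts_at A p"
  note C = charts_atD[OF assms(1) c]
  show "\<exists>\<epsilon>>0. \<exists>x. filippov_geodesic A g c {-\<epsilon><..<\<epsilon>} x \<and> x C1_differentiable_on {-\<epsilon><..<\<epsilon>} \<and>
      x 0 = snd c p \<and> (x has_vector_derivative \<xi> c) (at 0)"
  proof (rule filippov_geodesic_existence)
    show "snd c p \<in> chart_image c" using C by (simp add: chart_image_def)
    show "open (chart_image c)" using C by (simp add: is_chart_def)
    show "locally_lipschitz_on (chart_image c) (\<lambda>x. metric_comp A g c x $ i $ j)" for i j
      using assms(2) C by (auto simp: lipschitz_semi_riemannian_metric_def)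
    fix x assume "x \<in> chart_image c"
    \<comment> \<open>Invertibility at \<open>x\<close> comes from nondegeneracy at the point
      \<open>q\<close> of the manifold that lies over it.\<close>
    then obtain q where q: "q \<in> fst c" "x = snd c q" by (auto simp: chart_image_def)
    have "c \<in> charts_at A q" "q \<in> topspace M"
      using q C openin_subset by (auto simp: charts_at_def)
    then show "invertible (metric_comp A g c x)"
      unfolding q(2) using assms(2)
      by (intro invertible_metric_comp[OF assms(1)]) (auto simp: lipschitz_semi_riemannian_metric_def)
  qed
qed

end
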